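(* Let $D\ge2$. (i) The algebra $\mathbf R$ is isomorphic to \[ \begin{cases} \bigoplus_{k=1}^{\frac{D+1}{2}}\mathrm{End}(\mathbb C^k) & \text{if } D \text{ is odd},\\ 4\cdot\mathrm{End}(\mathbb C^{\frac{D+2}{4}})\oplus 8\cdot\bigoplus_{k=1}^{\frac{D-2}{4}}\mathrm{End}(\mathbb C^k) & \text{if } D\equiv2\pmod4,\\ \mathrm{End}(\mathbb C^{\frac D4+1})\oplus7\cdot\mathrm{End}(\mathbb C^{\frac D4})\oplus 8\cdot\bigoplus_{k=1}^{\frac D4-1}\mathrm{End}(\mathbb C^k) & \text{if } D\equiv0\pmod4. \end{cases} \] (ii) $\dim\mathbf R=\binom{\lfloor D/2\rfloor+3}{3}+\binom{\lceil D/2\rceil+1}{3}$.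
   Context: Let $X$ be the power set of a $D$-element set, and for $x,y\in X$ write $(x,y)\in R_2$ if $|x\triangle y|=2$. $\mathbb C^X$ is the vector space with basis $X$. Define linear maps on $\mathbb C^X$ by $\mathbf A_2^Jx=\sum_{|y|=|x|,(x,y)\in R_2}y$, $\mathbf A_2^{\bar J}x=\sum_{|y|\ne|x|,(x,y)\in R_2}y$, and $\mathbf A_2^*x=\frac{(D-2|x|)^2-D}{2}x$. $\mathbf R$ is the subalgebra of $\mathrm{End}(\mathbb C^X)$ generated by $\mathbf A_2^J,\mathbf A_2^{\bar J},\mathbf A_2^*$. For a vector space $V$ and integer $n\ge1$, $n\cdot V$ denotes the direct sum of $n$ copies of $V$. *)

theory Defs
  imports "HOL-Analysis.Analysis" "HOL-Library.Function_Algebras"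
begin

text \<open>The vertex set X = power set of {0,...,D-1}.  Linear maps on C^X are
represented by their matrices M :: nat set => nat set => complex, where
M y x is the coefficient of basis vector y in the image of basis vector x;
entries outside X x X are required to be zero.\<close>

type_synonym cmat = "nat set \<Rightarrow> nat set \<Rightarrow> complex"

definition Xs :: "nat \<Rightarrow> nat set set" where
  "Xs D = Pow {..<D}"

definition mmul :: "nat \<Rightarrow> cmat \<Rightarrow> cmat \<Rightarrow> cmat" where
  "mmul D A B = (\<lambda>y x. if y \<in> Xs D \<and> x \<in> Xs D then (\<Sum>z\<in>Xs D. A y z * B z x) else 0)"

definition madd :: "cmat \<Rightarrow> cmat \<Rightarrow> cmat" where
  "madd A B = (\<lambda>y x. A y x + B y x)"

definition msmult :: "complex \<Rightarrow> cmat \<Rightarrow> cmat" where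
  "msmult c A = (\<lambda>y x. c * A y x)"

definition mid :: "nat \<Rightarrow> cmat" where
  "mid D = (\<lambda>y x. if y \<in> Xs D \<and> x \<in> Xs D \<and> y = x then 1 else 0)"

definition A2J :: "nat \<Rightarrow> cmat" where
  "A2J D = (\<lambda>y x. if y \<in> Xs D \<and> x \<in> Xs D \<and> card ((x - y) \<union> (y - x)) = 2 \<and> card y = card x
                  then 1 else 0)"

definition A2Jbar :: "nat \<Rightarrow> cmat" where
  "A2Jbar D = (\<lambda>y x. if y \<in> Xs D \<and> x \<in> Xs D \<and> card ((x - y) \<union> (y - x)) = 2 \<and> card y \<noteq> card x
                  then 1 else 0)"

definition A2star :: "nat \<Rightarrow> cmat" where
  "A2star D = (\<lambda>y x. if y \<in> Xs D \<and> x \<in> Xs D \<and> y = x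
                  then complex_of_int (((int D - 2 * int (card x))\<^sup>2 - int D)) / 2 else 0)"

inductive_set Ralg :: "nat \<Rightarrow> cmat set" for D :: nat where
  gen_J: "A2J D \<in> Ralg D"
| gen_Jbar: "A2Jbar D \<in> Ralg D"
| gen_star: "A2star D \<in> Ralg D"
| unit: "mid D \<in> Ralg D"
| add: "A \<in> Ralg D \<Longrightarrow> B \<in> Ralg D \<Longrightarrow> madd A B \<in> Ralg D"
| smult: "A \<in> Ralg D \<Longrightarrow> msmult c A \<in> Ralg D"
| mult: "A \<in> Ralg D \<Longrightarrow> B \<in> Ralg D \<Longrightarrow> mmul D A B \<in> Ralg D"

text \<open>Direct sums of full matrix algebras: block i is an (ns!i) x (ns!i)
complex matrix; elements are functions i j k, zero outside the blocks.\<close>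
type_synonym bmat = "nat \<Rightarrow> nat \<Rightarrow> nat \<Rightarrow> complex"

definition BlockAlg :: "nat list \<Rightarrow> bmat set" where
  "BlockAlg ns = {M. \<forall>i j k. \<not> (i < length ns \<and> j < ns ! i \<and> k < ns ! i) \<longrightarrow> M i j k = 0}"

definition badd :: "bmat \<Rightarrow> bmat \<Rightarrow> bmat" where
  "badd M N = (\<lambda>i j k. M i j k + N i j k)"

definition bsmult :: "complex \<Rightarrow> bmat \<Rightarrow> bmat" where
  "bsmult c M = (\<lambda>i j k. c * M i j k)"

definition bmul :: "nat list \<Rightarrow> bmat \<Rightarrow> bmat \<Rightarrow> bmat" where
  "bmul ns M N = (\<lambda>i j k. if i < length ns \<and> j < ns ! i \<and> k < ns ! i
                     then (\<Sum>l<ns ! i. M i j l * N i l k) else 0)"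

definition bone :: "nat list \<Rightarrow> bmat" where
  "bone ns = (\<lambda>i j k. if i < length ns \<and> j < ns ! i \<and> j = k then 1 else 0)"

definition R_iso_Blocks :: "nat \<Rightarrow> nat list \<Rightarrow> bool" where
  "R_iso_Blocks D ns \<longleftrightarrow> (\<exists>f. bij_betw f (Ralg D) (BlockAlg ns) \<and>
      (\<forall>A\<in>Ralg D. \<forall>B\<in>Ralg D. f (madd A B) = badd (f A) (f B)) \<and>
      (\<forall>A\<in>Ralg D. \<forall>c. f (msmult c A) = bsmult c (f A)) \<and>
      (\<forall>A\<in>Ralg D. \<forall>B\<in>Ralg D. f (mmul D A B) = bmul ns (f A) (f B)) \<and>
      f (mid D) = bone ns)"

definition eight_blocks :: "nat \<Rightarrow> nat list" where
  "eight_blocks m = concat (map (\<lambda>k. replicate 8 k) [1..<m+1])"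

definition block_sizes :: "nat \<Rightarrow> nat list" where
  "block_sizes D =
    (if odd D then [1..<(D+1) div 2 + 1]
     else if D mod 4 = 2 then replicate 4 ((D+2) div 4) @ eight_blocks ((D-2) div 4)
     else [D div 4 + 1] @ replicate 7 (D div 4) @ eight_blocks (D div 4 - 1))"

end

theory Submission
  imports Defs
begin

text \<open>
  With the raising and lowering operators \<open>E\<close>, \<open>F\<close> of \<open>sl\<^sub>2\<close> on the Boolean lattice and the weight
  \<open>H = D - 2|x|\<close>, the generators are \<open>(EF + FE - D)/2\<close>, \<open>(E\<^sup>2 + F\<^sup>2)/2\<close> and \<open>(H\<^sup>2 - D)/2\<close>.
  A matching \<open>M\<close> with \<open>m\<close> edges \<open>(a, b)\<close> gives the function \<open>\<Prod>(1\<^sub>a - 1\<^sub>b)\<close>; its restrictions to the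
  sets of size \<open>s\<close>, for \<open>m \<le> s \<le> D - m\<close>, form a weight basis of an irreducible module of
  dimension \<open>D - 2m + 1\<close>, and all these modules together span.
  The generators commute with complementation and preserve the parity of \<open>|x|\<close>. Hence for odd \<open>D\<close>
  each module splits into two parity parts, exchanged by complementation, and for even \<open>D\<close> into four
  parts (parity and sign under complementation). On every part \<open>H\<^sup>2\<close> is diagonal with distinct
  eigenvalues, and \<open>E\<^sup>2 + F\<^sup>2\<close> is tridiagonal with nonzero off-diagonal entries.
  Interpolation in the first and third generators isolates the pairs \<open>(m, H\<^sup>2)\<close>, and the second
  generator then separates the two signs and moves between the eigenvalues, so that all matrix
  units of all parts are obtained.
\<close>

subsection \<open>Signed layers of a matching\<close>

fun sgn_prod :: "(nat \<times> nat) list \<Rightarrow> nat set \<Rightarrow> complex" where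
  "sgn_prod [] y = 1"
| "sgn_prod ((a, b) # M) y = (of_bool (a \<in> y) - of_bool (b \<in> y)) * sgn_prod M y"

definition verts :: "(nat \<times> nat) list \<Rightarrow> nat set" where
  "verts M = fst ` set M \<union> snd ` set M"

text \<open>Edges are oriented pairs in a list: reversing an edge only changes the overall sign of
  \<open>sgn_prod\<close>, and lists allow induction over the edges.\<close>

definition matching :: "nat \<Rightarrow> (nat \<times> nat) list \<Rightarrow> bool" where
  "matching D M \<longleftrightarrow> distinct (map fst M @ map snd M) \<and> verts M \<subseteq> {..<D}"

lemma finite_verts [simp]: "finite (verts M)"
  by (simp add: verts_def)

lemma verts_Nil [simp]: "verts [] = {}"
  by (simp add: verts_def)

lemma verts_Cons [simp]: "verts ((a, b) # M) = insert a (insert b (verts M))"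
  by (auto simp: verts_def)

lemma matching_Nil [simp]: "matching D []"
  by (simp add: matching_def)

lemma matching_Cons:
  "matching D ((a, b) # M) \<longleftrightarrow>
     matching D M \<and> a < D \<and> b < D \<and> a \<noteq> b \<and> a \<notin> verts M \<and> b \<notin> verts M"
  by (auto simp: matching_def verts_def)

lemma card_verts: "matching D M \<Longrightarrow> card (verts M) = 2 * length M"
proof (induction M)
  case (Cons p M)
  then show ?case by (cases p) (auto simp: matching_Cons)
qed simp

lemma sgn_prod_insert [simp]: "c \<notin> verts M \<Longrightarrow> sgn_prod M (insert c y) = sgn_prod M y"
  by (induction M y rule: sgn_prod.induct) auto

lemma sgn_prod_remove [simp]: "c \<notin> verts M \<Longrightarrow> sgn_prod M (y - {c}) = sgn_prod M y"
  by (induction M y rule: sgn_prod.induct) auto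

lemma sgn_prod_compl:
  assumes "matching D M"
  shows "sgn_prod M ({..<D} - y) = (-1) ^ length M * sgn_prod M y"
  using assms by (induction M y rule: sgn_prod.induct) (auto simp: matching_Cons)

text \<open>A factor of the product is nonzero only if \<open>y\<close> contains exactly one
  endpoint of that edge.\<close>

lemma card_Int_verts:
  assumes "matching D M" "sgn_prod M y \<noteq> 0"
  shows "card (y \<inter> verts M) = length M"
  using assms
proof (induction M)
  case (Cons p M)
  obtain a b where p: "p = (a, b)" by (cases p)
  have IH: "card (y \<inter> verts M) = length M" using Cons p by (auto simp: matching_Cons)
  have nin: "a \<notin> verts M" "b \<notin> verts M" using Cons.prems p by (auto simp: matching_Cons)
  have "y \<inter> verts (p # M) = insert a (y \<inter> verts M) \<or> y \<inter> verts (p # M) = insert b (y \<inter> verts M)"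
    using Cons.prems p by (auto split: if_splits)
  then show ?case using IH nin by auto
qed simp

lemma card_eq_length_plus_rest:
  assumes "matching D M" "sgn_prod M y \<noteq> 0" "y \<subseteq> {..<D}"
  shows "card y = length M + card (y \<inter> ({..<D} - verts M))"
proof -
  have "finite y" using assms(3) finite_subset by blast
  have "y = (y \<inter> verts M) \<union> (y \<inter> ({..<D} - verts M))" using assms(3) by auto
  then have "card y = card (y \<inter> verts M) + card (y \<inter> ({..<D} - verts M))"
    by (metis card_Un_disjoint Diff_disjoint \<open>finite y\<close> finite_Int inf_assoc inf_bot_right inf_commute)
  then show ?thesis using card_Int_verts[OF assms(1,2)] by simp
qed

text \<open>On its support the function picks one endpoint of each edge and misses the other. This
  bounds the range of weights occurring in the irreducible module.\<close>

lemma card_bounds: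
  assumes "matching D M" "sgn_prod M y \<noteq> 0" "y \<subseteq> {..<D}"
  shows "length M \<le> card y" "card y + length M \<le> D"
proof -
  have V: "verts M \<subseteq> {..<D}" using assms(1) by (simp add: matching_def)
  have "card (y \<inter> ({..<D} - verts M)) \<le> card ({..<D} - verts M)"
    by (rule card_mono) auto
  also have "\<dots> = D - 2 * length M"
    using V card_verts[OF assms(1)] by (simp add: card_Diff_subset)
  finally have 1: "card (y \<inter> ({..<D} - verts M)) \<le> D - 2 * length M" .
  have "card (verts M) \<le> D" using card_mono[OF _ V] by simp
  then have "2 * length M \<le> D" using card_verts[OF assms(1)] by simp
  then show "length M \<le> card y" "card y + length M \<le> D"
    using card_eq_length_plus_rest[OF assms] 1 by auto
qed

text \<open>If \<open>y\<close> contains one endpoint of every edge, removing such an endpoint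
  annihilates the product, and the remaining |y| - m removals do not change it. If both ends of an
  edge lie in \<open>y\<close>, their two removals cancel. The induction covers all cases by
  correcting the factor of one edge at c = a and c = b.\<close>

lemma sum_sgn_prod_remove:
  assumes "matching D M" "y \<subseteq> {..<D}"
  shows "(\<Sum>c\<in>y. sgn_prod M (y - {c})) = (of_nat (card y) - of_nat (length M)) * sgn_prod M y"
  using assms(1)
proof (induction M)
  case (Cons p M)
  obtain a b where p: "p = (a, b)" by (cases p)
  have fin: "finite y" using assms(2) finite_subset by blast
  have M: "matching D M" "a \<noteq> b" "a \<notin> verts M" "b \<notin> verts M"
    using Cons.prems p by (auto simp: matching_Cons)
  have "(\<Sum>c\<in>y. sgn_prod (p # M) (y - {c})) =
     (\<Sum>c\<in>y. (of_bool (a \<in> y) - of_bool (b \<in> y)) * sgn_prod M (y - {c})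
        - (if c = a then sgn_prod M y else 0) + (if c = b then sgn_prod M y else 0))"
    using M by (intro sum.cong) (auto simp: p algebra_simps)
  also have "\<dots> = (of_bool (a \<in> y) - of_bool (b \<in> y)) * (\<Sum>c\<in>y. sgn_prod M (y - {c}))
       - of_bool (a \<in> y) * sgn_prod M y + of_bool (b \<in> y) * sgn_prod M y"
    using fin by (simp add: sum.distrib sum_subtractf sum_distrib_left)
  also have "\<dots> = (of_nat (card y) - of_nat (length (p # M))) * sgn_prod (p # M) y"
    using Cons.IH[OF M(1)] by (simp add: p algebra_simps)
  finally show ?case .
qed simp

text \<open>The mirror image of \<open>sum_sgn_prod_remove\<close>: on the support, m of the D - |y|
  points outside \<open>y\<close> are endpoints whose insertion annihilates a factor.\<close>

lemma sum_sgn_prod_insert: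
  assumes "matching D M" "y \<subseteq> {..<D}"
  shows "(\<Sum>c\<in>{..<D} - y. sgn_prod M (insert c y)) =
    (of_nat D - of_nat (card y) - of_nat (length M)) * sgn_prod M y"
  using assms(1)
proof (induction M)
  case Nil
  have "finite y" using assms(2) finite_subset by blast
  then have "card ({..<D} - y) = D - card y" "card y \<le> D"
    using assms(2) card_mono[of "{..<D}" y] by (auto simp: card_Diff_subset)
  then show ?case by (simp add: of_nat_diff)
next
  case (Cons p M)
  obtain a b where p: "p = (a, b)" by (cases p)
  have M: "matching D M" "a \<noteq> b" "a \<notin> verts M" "b \<notin> verts M" "a < D" "b < D"
    using Cons.prems p by (auto simp: matching_Cons)
  have "(\<Sum>c\<in>{..<D} - y. sgn_prod (p # M) (insert c y)) =
     (\<Sum>c\<in>{..<D} - y. (of_bool (a \<in> y) - of_bool (b \<in> y)) * sgn_prod M (insert c y)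
        + (if c = a then sgn_prod M y else 0) - (if c = b then sgn_prod M y else 0))"
    using M by (intro sum.cong) (auto simp: p algebra_simps)
  also have "\<dots> = (of_bool (a \<in> y) - of_bool (b \<in> y)) * (\<Sum>c\<in>{..<D} - y. sgn_prod M (insert c y))
       + of_bool (a \<notin> y) * sgn_prod M y - of_bool (b \<notin> y) * sgn_prod M y"
    using M by (simp add: sum.distrib sum_subtractf sum_distrib_left)
  also have "\<dots> = (of_nat D - of_nat (card y) - of_nat (length (p # M))) * sgn_prod (p # M) y"
    using Cons.IH[OF M(1)] by (simp add: p algebra_simps)
  finally show ?case .
qed

section \<open>Action of the three generators on the layers\<close>

definition layer :: "nat \<Rightarrow> (nat \<times> nat) list \<Rightarrow> int \<Rightarrow> nat set \<Rightarrow> complex" where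
  "layer D M s y = (if y \<in> Xs D \<and> int (card y) = s then sgn_prod M y else 0)"

definition app :: "nat \<Rightarrow> cmat \<Rightarrow> (nat set \<Rightarrow> complex) \<Rightarrow> nat set \<Rightarrow> complex" where
  "app D A v y = (\<Sum>z\<in>Xs D. A y z * v z)"

text \<open>The coefficient of half the squared raising operator from level s to s + 2; by
  complementation the lowering coefficient is \<open>up m (int D - s)\<close>. Levels are integers,
  so that shifts and reflections of a level need no truncated subtraction.\<close>

definition up :: "nat \<Rightarrow> int \<Rightarrow> complex" where
  "up m s = of_int ((s + 1 - int m) * (s + 2 - int m)) / 2"

lemma finite_Xs [simp]: "finite (Xs D)"
  by (simp add: Xs_def)

lemma Xs_card_le: "y \<in> Xs D \<Longrightarrow> card y \<le> D"
  using card_mono[of "{..<D}" y] by (simp add: Xs_def)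

lemma Xs_finite: "y \<in> Xs D \<Longrightarrow> finite y"
  using finite_subset[of y "{..<D}"] by (simp add: Xs_def)

lemma layer_eq_0:
  assumes "matching D M" "s < int (length M) \<or> s > int D - int (length M)"
  shows "layer D M s y = 0"
proof (rule ccontr)
  assume "layer D M s y \<noteq> 0"
  then have "y \<subseteq> {..<D}" "int (card y) = s" "sgn_prod M y \<noteq> 0"
    by (auto simp: layer_def Xs_def split: if_splits)
  then show False using card_bounds[OF assms(1)] assms(2) by force
qed

lemma app_A2star:
  "app D (A2star D) (layer D M s) =
     (\<lambda>y. of_int ((int D - 2 * s)\<^sup>2 - int D) / 2 * layer D M s y)"
proof
  fix y
  have "app D (A2star D) (layer D M s) y = (\<Sum>z\<in>Xs D. if y = z then
      (if y \<in> Xs D then complex_of_int (((int D - 2 * int (card y))\<^sup>2 - int D)) / 2 * layer D M s y else 0) else 0)"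
    unfolding app_def by (intro sum.cong) (auto simp: A2star_def)
  also have "\<dots> = of_int ((int D - 2 * s)\<^sup>2 - int D) / 2 * layer D M s y"
    by (auto simp: layer_def)
  finally show "app D (A2star D) (layer D M s) y = \<dots>" .
qed

text \<open>The neighbours of \<open>y\<close> on its own level arise by exchanging one element of
  \<open>y\<close> for one point outside.\<close>

lemma app_A2J_swap:
  assumes "y \<in> Xs D"
  shows "app D (A2J D) v y = (\<Sum>c\<in>y. \<Sum>c'\<in>{..<D} - y. v (insert c' (y - {c})))"
proof -
  have fin: "finite y" and sub: "y \<subseteq> {..<D}" using assms Xs_finite by (auto simp: Xs_def)
  let ?Z = "{z \<in> Xs D. card ((z - y) \<union> (y - z)) = 2 \<and> card y = card z}"
  let ?h = "\<lambda>(c, c'). insert c' (y - {c})"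
  have "app D (A2J D) v y = (\<Sum>z\<in>Xs D. if card ((z - y) \<union> (y - z)) = 2 \<and> card y = card z then v z else 0)"
    unfolding app_def using assms by (intro sum.cong) (auto simp: A2J_def)
  also have "\<dots> = sum v ?Z" by (simp add: sum.inter_filter)
  also have "\<dots> = (\<Sum>p\<in>y \<times> ({..<D} - y). v (?h p))"
  proof (rule sum.reindex_bij_betw[symmetric])
    have inj: "inj_on ?h (y \<times> ({..<D} - y))"
    proof (rule inj_onI, clarify)
      fix c d c' d' assume *: "c \<in> y" "d \<in> y" "c' \<notin> y" "d' \<notin> y"
        and eq: "insert c' (y - {c}) = insert d' (y - {d})"
      have "c' \<in> insert d' (y - {d})" unfolding eq[symmetric] by simp
      moreover have "c \<notin> insert d' (y - {d})" unfolding eq[symmetric] using * by auto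
      ultimately show "c = d \<and> c' = d'" using * by auto
    qed
    have im: "?h ` (y \<times> ({..<D} - y)) = ?Z"
    proof (intro equalityI subsetI)
      fix z assume "z \<in> ?h ` (y \<times> ({..<D} - y))"
      then obtain c c' where z: "z = insert c' (y - {c})" "c \<in> y" "c' < D" "c' \<notin> y" by auto
      have "(z - y) \<union> (y - z) = {c, c'}" using z by auto
      moreover have "card z = card y" using z fin card_Suc_Diff1[OF fin z(2)] by simp
      ultimately show "z \<in> ?Z" using z sub by (auto simp: Xs_def)
    next
      fix z assume z: "z \<in> ?Z"
      have finz: "finite z" using z Xs_finite by blast
      have "card (z - y) + card (y - z) = 2"
        using z fin finz card_Un_disjoint[of "z - y" "y - z"] by auto
      \<comment> \<open>Equal sizes force the two one-sided differences to be equally large, so each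
        is a single point.\<close>
      moreover have "card (z - y) = card (y - z)"
        using z fin finz card_Diff_subset_Int[of z y] card_Diff_subset_Int[of y z] by (simp add: Int_commute)
      ultimately have "card (z - y) = 1" "card (y - z) = 1" by auto
      then obtain c c' where cc: "z - y = {c'}" "y - z = {c}" by (auto simp: card_1_singleton_iff)
      then have "z = insert c' (y - {c})" by blast
      moreover have "c' < D" using cc z by (auto simp: Xs_def)
      ultimately show "z \<in> ?h ` (y \<times> ({..<D} - y))" using cc by force
    qed
    show "bij_betw ?h (y \<times> ({..<D} - y)) ?Z" using inj im by (simp add: bij_betw_def)
  qed
  also have "\<dots> = (\<Sum>c\<in>y. \<Sum>c'\<in>{..<D} - y. v (insert c' (y - {c})))"
    by (simp add: sum.cartesian_product case_prod_beta)
  finally show ?thesis .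
qed

text \<open>Summing first over insertions and then over removals gives (D - s + 1 - m)(s - m) - s,
  which is the stated eigenvalue after expansion.\<close>

lemma app_A2J:
  assumes "matching D M"
  shows "app D (A2J D) (layer D M s) =
    (\<lambda>y. of_int (s * (int D - s) - int (length M) * (int D + 1 - int (length M))) * layer D M s y)"
proof
  fix y
  show "app D (A2J D) (layer D M s) y =
    of_int (s * (int D - s) - int (length M) * (int D + 1 - int (length M))) * layer D M s y"
  proof (cases "y \<in> Xs D")
    case False
    then show ?thesis by (simp add: app_def A2J_def layer_def)
  next
    case y: True
    have fin: "finite y" and sub: "y \<subseteq> {..<D}" using y Xs_finite by (auto simp: Xs_def)
    have mem: "insert c' (y - {c}) \<in> Xs D \<and> card (insert c' (y - {c})) = card y"
      if "c \<in> y" "c' \<in> {..<D} - y" for c c'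
      using that sub fin card_Suc_Diff1[OF fin that(1)] by (auto simp: Xs_def)
    have "app D (A2J D) (layer D M s) y =
       (\<Sum>c\<in>y. \<Sum>c'\<in>{..<D} - y. of_bool (int (card y) = s) * sgn_prod M (insert c' (y - {c})))"
      unfolding app_A2J_swap[OF y] using mem by (intro sum.cong) (auto simp: layer_def)
    also have "\<dots> = of_bool (int (card y) = s) *
        (\<Sum>c\<in>y. (of_nat D - of_nat (card y) + 1 - of_nat (length M)) * sgn_prod M (y - {c}) - sgn_prod M y)"
      unfolding sum_distrib_left
    proof (rule sum.cong[OF refl], goal_cases)
      case (1 c)
      \<comment> \<open>The insertion formula for \<open>y - {c}\<close> also counts putting c back,
        which is no exchange; this term is split off and later accounts for the summand -s.\<close>
      have "{..<D} - (y - {c}) = insert c ({..<D} - y)" using 1 sub by auto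
      then have "(\<Sum>c'\<in>{..<D} - (y - {c}). sgn_prod M (insert c' (y - {c}))) =
          sgn_prod M y + (\<Sum>c'\<in>{..<D} - y. sgn_prod M (insert c' (y - {c})))"
        using 1 by (simp add: insert_absorb)
      moreover have "of_nat (card (y - {c})) = (of_nat (card y) - 1 :: complex)"
        using 1 fin by (metis add_diff_cancel_left' card.remove of_nat_Suc)
      moreover have "y - {c} \<subseteq> {..<D}" using sub by auto
      ultimately have "(of_nat D - (of_nat (card y) - 1) - of_nat (length M)) * sgn_prod M (y - {c}) =
          sgn_prod M y + (\<Sum>c'\<in>{..<D} - y. sgn_prod M (insert c' (y - {c})))"
        using sum_sgn_prod_insert[OF assms, of "y - {c}"] by simp
      then have "(\<Sum>c'\<in>{..<D} - y. sgn_prod M (insert c' (y - {c}))) =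
         (of_nat D - of_nat (card y) + 1 - of_nat (length M)) * sgn_prod M (y - {c}) - sgn_prod M y"
        by (simp add: algebra_simps)
      then show ?case by (simp add: sum_distrib_left)
    qed
    also have "\<dots> = of_bool (int (card y) = s) * (((of_nat D - of_nat (card y) + 1 - of_nat (length M)) *
       (of_nat (card y) - of_nat (length M)) - of_nat (card y)) * sgn_prod M y)"
      unfolding sum_subtractf sum_distrib_left[symmetric] sum_sgn_prod_remove[OF assms sub]
      by (simp add: algebra_simps)
    also have "\<dots> = of_int (s * (int D - s) - int (length M) * (int D + 1 - int (length M))) * layer D M s y"
    proof (cases "int (card y) = s")
      case True
      then have "of_nat (card y) = (of_int s :: complex)" by (metis of_int_of_nat_eq)
      then show ?thesis using True y by (simp add: layer_def algebra_simps)
    qed (simp add: layer_def)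
    finally show ?thesis .
  qed
qed

lemma sum_ordered_pairs:
  fixes v :: "nat set \<Rightarrow> complex"
  assumes fin: "finite U"
  shows "(\<Sum>c\<in>U. \<Sum>c'\<in>U - {c}. v {c, c'}) = 2 * (\<Sum>e | e \<subseteq> U \<and> card e = 2. v e)"
proof -
  let ?P = "Sigma U (\<lambda>c. U - {c})" and ?T = "{e. e \<subseteq> U \<and> card e = 2}"
  let ?h = "\<lambda>(c, c'). {c, c'}"
  have finT: "finite ?T" using fin by (rule_tac finite_subset[of _ "Pow U"]) auto
  have "(\<Sum>c\<in>U. \<Sum>c'\<in>U - {c}. v {c, c'}) = (\<Sum>p\<in>?P. v (?h p))"
    using fin by (simp add: sum.Sigma case_prod_beta)
  also have "\<dots> = (\<Sum>e\<in>?T. \<Sum>p\<in>{p\<in>?P. ?h p = e}. v (?h p))"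
    using fin finT by (intro sum.group[symmetric]) auto
  also have "\<dots> = (\<Sum>e\<in>?T. 2 * v e)"
  proof (rule sum.cong[OF refl])
    fix e assume "e \<in> ?T"
    then obtain a b where e: "e = {a, b}" "a \<noteq> b" "a \<in> U" "b \<in> U" by (auto simp: card_2_iff)
    have "{p\<in>?P. ?h p = e} = {(a, b), (b, a)}" using e by (auto simp: doubleton_eq_iff)
    then show "(\<Sum>p\<in>{p\<in>?P. ?h p = e}. v (?h p)) = 2 * v e"
      using e by (simp add: insert_commute)
  qed
  finally show ?thesis by (simp add: sum_distrib_left)
qed

lemma app_A2Jbar_pairs:
  assumes "y \<in> Xs D"
  shows "app D (A2Jbar D) v y =
    (\<Sum>e | e \<subseteq> y \<and> card e = 2. v (y - e)) + (\<Sum>e | e \<subseteq> {..<D} - y \<and> card e = 2. v (y \<union> e))"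
proof -
  have fin: "finite y" and sub: "y \<subseteq> {..<D}" using assms Xs_finite by (auto simp: Xs_def)
  let ?Z = "{z \<in> Xs D. card ((z - y) \<union> (y - z)) = 2 \<and> card y \<noteq> card z}"
  let ?d = "{e. e \<subseteq> y \<and> card e = 2}" and ?u = "{e. e \<subseteq> {..<D} - y \<and> card e = 2}"
  have finite: "finite ?d" "finite ?u"
    using fin by (auto intro: finite_subset[of _ "Pow y"] finite_subset[of _ "Pow ({..<D} - y)"])
  have fe: "finite e" if "card e = 2" for e :: "nat set" using that card.infinite by fastforce
  have Z: "?Z = (\<lambda>e. y - e) ` ?d \<union> (\<lambda>e. y \<union> e) ` ?u"
  proof (intro equalityI subsetI)
    fix z assume z: "z \<in> ?Z"
    have finz: "finite z" using z Xs_finite by blast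
    have s: "card (z - y) + card (y - z) = 2"
      using z fin finz card_Un_disjoint[of "z - y" "y - z"] by auto
    have "card z = card (z \<inter> y) + card (z - y)" "card y = card (z \<inter> y) + card (y - z)"
      using finz fin card_Diff_subset_Int[of z y] card_Diff_subset_Int[of y z] 
        card_mono[of z "z \<inter> y"] card_mono[of y "z \<inter> y"] by (auto simp: Int_commute)
    \<comment> \<open>Different sizes exclude the split 1 + 1 of the symmetric difference, so one of
      the sets contains the other.\<close>
    then have "card (z - y) \<noteq> card (y - z)" using z by auto
    then consider "card (z - y) = 0" "card (y - z) = 2" | "card (z - y) = 2" "card (y - z) = 0"
      using s by linarith
    then show "z \<in> (\<lambda>e. y - e) ` ?d \<union> (\<lambda>e. y \<union> e) ` ?u"
    proof cases
      case 1
      then have "z = y - (y - z)" using finz by auto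
      then show ?thesis using 1 by blast
    next
      case 2
      then have "z = y \<union> (z - y)" using fin by auto
      moreover have "z - y \<in> ?u" using 2 z by (auto simp: Xs_def)
      ultimately show ?thesis by blast
    qed
  next
    fix z assume "z \<in> (\<lambda>e. y - e) ` ?d \<union> (\<lambda>e. y \<union> e) ` ?u"
    then consider e where "e \<in> ?d" "z = y - e" | e where "e \<in> ?u" "z = y \<union> e" by blast
    then show "z \<in> ?Z"
    proof cases
      case 1
      have "(z - y) \<union> (y - z) = e" using 1 by auto
      moreover have "card z = card y - 2" using 1 fe fin by (auto simp: card_Diff_subset)
      moreover have "card y \<ge> 2" using 1 fin card_mono[of y e] by auto
      ultimately show ?thesis using 1 sub by (auto simp: Xs_def)
    next
      case 2
      have "(z - y) \<union> (y - z) = e" using 2 by auto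
      moreover have "card z = card y + 2" using 2 fe fin by (subst 2(2), subst card_Un_disjoint) auto
      ultimately show ?thesis using 2 sub by (auto simp: Xs_def)
    qed
  qed
  have disj: "(\<lambda>e. y - e) ` ?d \<inter> (\<lambda>e. y \<union> e) ` ?u = {}"
  proof -
    have False if "e \<in> ?d" "e' \<in> ?u" "y - e = y \<union> e'" for e e'
    proof -
      have "e' = {}" using that by blast
      then show False using that by simp
    qed
    then show ?thesis by blast
  qed
  have "app D (A2Jbar D) v y = (\<Sum>z\<in>Xs D. if card ((z - y) \<union> (y - z)) = 2 \<and> card y \<noteq> card z then v z else 0)"
    unfolding app_def using assms by (intro sum.cong) (auto simp: A2Jbar_def)
  also have "\<dots> = sum v ?Z" by (simp add: sum.inter_filter)
  also have "\<dots> = sum v ((\<lambda>e. y - e) ` ?d) + sum v ((\<lambda>e. y \<union> e) ` ?u)"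
    unfolding Z using finite disj by (intro sum.union_disjoint) auto
  also have "sum v ((\<lambda>e. y - e) ` ?d) = (\<Sum>e\<in>?d. v (y - e))"
    by (subst sum.reindex) (auto simp: inj_on_def)
  also have "sum v ((\<lambda>e. y \<union> e) ` ?u) = (\<Sum>e\<in>?u. v (y \<union> e))"
  proof (subst sum.reindex)
    show "inj_on (\<lambda>e. y \<union> e) ?u" by (rule inj_onI) blast
  qed auto
  finally show ?thesis .
qed

text \<open>The sums over two-element sets become ordered double sums, to which the one-point
  removal or insertion formula applies twice. Each unordered pair is counted twice, whence the half
  in \<open>up\<close>.\<close>

lemma app_A2Jbar:
  assumes "matching D M"
  shows "app D (A2Jbar D) (layer D M s) =
    (\<lambda>y. up (length M) s * layer D M (s + 2) y + up (length M) (int D - s) * layer D M (s - 2) y)"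
proof
  fix y
  let ?m = "of_nat (length M) :: complex"
  show "app D (A2Jbar D) (layer D M s) y =
    up (length M) s * layer D M (s + 2) y + up (length M) (int D - s) * layer D M (s - 2) y"
  proof (cases "y \<in> Xs D")
    case False
    then show ?thesis by (simp add: app_def A2Jbar_def layer_def)
  next
    case y: True
    have fin: "finite y" and sub: "y \<subseteq> {..<D}" using y Xs_finite by (auto simp: Xs_def)
    have fe: "finite e" if "card e = 2" for e :: "nat set" using that card.infinite by fastforce
    have "2 * (\<Sum>e | e \<subseteq> y \<and> card e = 2. sgn_prod M (y - e)) = (\<Sum>c\<in>y. \<Sum>c'\<in>y - {c}. sgn_prod M (y - {c, c'}))"
      using sum_ordered_pairs[OF fin, of "\<lambda>e. sgn_prod M (y - e)"] by simp
    also have "\<dots> = (\<Sum>c\<in>y. (of_nat (card y) - 1 - ?m) * sgn_prod M (y - {c}))"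
    proof (rule sum.cong[OF refl], goal_cases)
      case (1 c)
      have "of_nat (card (y - {c})) = (of_nat (card y) - 1 :: complex)"
        using 1 fin by (metis add_diff_cancel_left' card.remove of_nat_Suc)
      moreover have "(\<Sum>c'\<in>y - {c}. sgn_prod M (y - {c, c'})) = (\<Sum>c'\<in>y - {c}. sgn_prod M (y - {c} - {c'}))"
        by (intro sum.cong refl arg_cong[of _ _ "sgn_prod M"]) auto
      ultimately show ?case using sum_sgn_prod_remove[OF assms, of "y - {c}"] sub by auto
    qed
    also have "\<dots> = (of_nat (card y) - 1 - ?m) * (of_nat (card y) - ?m) * sgn_prod M y"
      by (simp add: sum_distrib_left[symmetric] sum_sgn_prod_remove[OF assms sub])
    finally have down: "2 * (\<Sum>e | e \<subseteq> y \<and> card e = 2. sgn_prod M (y - e)) = \<dots>" .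
    let ?V = "{..<D} - y"
    have "2 * (\<Sum>e | e \<subseteq> ?V \<and> card e = 2. sgn_prod M (y \<union> e)) = (\<Sum>c\<in>?V. \<Sum>c'\<in>?V - {c}. sgn_prod M (y \<union> {c, c'}))"
      using sum_ordered_pairs[of ?V "\<lambda>e. sgn_prod M (y \<union> e)"] by simp
    also have "\<dots> = (\<Sum>c\<in>?V. (of_nat D - of_nat (card y) - 1 - ?m) * sgn_prod M (insert c y))"
    proof (rule sum.cong[OF refl], goal_cases)
      case (1 c)
      have "of_nat (card (insert c y)) = (of_nat (card y) + 1 :: complex)"
        using 1 fin by auto
      moreover have "?V - {c} = {..<D} - insert c y" by auto
      moreover have "(\<Sum>c'\<in>{..<D} - insert c y. sgn_prod M (y \<union> {c, c'})) =
           (\<Sum>c'\<in>{..<D} - insert c y. sgn_prod M (insert c' (insert c y)))"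
        by (intro sum.cong refl arg_cong[of _ _ "sgn_prod M"]) auto
      ultimately show ?case using sum_sgn_prod_insert[OF assms, of "insert c y"] sub 1
        by (auto simp: algebra_simps)
    qed
    also have "\<dots> = (of_nat D - of_nat (card y) - 1 - ?m) * (of_nat D - of_nat (card y) - ?m) * sgn_prod M y"
      by (simp add: sum_distrib_left[symmetric] sum_sgn_prod_insert[OF assms sub])
    finally have upw: "2 * (\<Sum>e | e \<subseteq> ?V \<and> card e = 2. sgn_prod M (y \<union> e)) = \<dots>" .
    have c1: "y - e \<in> Xs D \<and> int (card (y - e)) = int (card y) - 2" if "e \<subseteq> y" "card e = 2" for e
      using that fe[OF that(2)] sub card_mono[OF fin that(1)] by (auto simp: Xs_def card_Diff_subset)
    have c2: "y \<union> e \<in> Xs D \<and> int (card (y \<union> e)) = int (card y) + 2" if "e \<subseteq> ?V" "card e = 2" for e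
      using that fe[OF that(2)] sub fin by (subst card_Un_disjoint) (auto simp: Xs_def)
    have "app D (A2Jbar D) (layer D M s) y =
      of_bool (int (card y) = s + 2) * (\<Sum>e | e \<subseteq> y \<and> card e = 2. sgn_prod M (y - e)) +
      of_bool (int (card y) = s - 2) * (\<Sum>e | e \<subseteq> ?V \<and> card e = 2. sgn_prod M (y \<union> e))"
      unfolding app_A2Jbar_pairs[OF y] sum_distrib_left using c1 c2
      by (intro arg_cong2[of _ _ _ _ "(+)"] sum.cong refl) (auto simp: layer_def)
    also have "\<dots> = up (length M) s * layer D M (s + 2) y + up (length M) (int D - s) * layer D M (s - 2) y"
    proof -
      have 1: "of_bool (int (card y) = s + 2) * (\<Sum>e | e \<subseteq> y \<and> card e = 2. sgn_prod M (y - e)) =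
          up (length M) s * layer D M (s + 2) y"
      proof (cases "int (card y) = s + 2")
        case True
        then have "of_nat (card y) = (of_int s + 2 :: complex)" by (metis of_int_of_nat_eq of_int_add of_int_numeral)
        with down True y show ?thesis by (simp add: layer_def up_def field_simps)
      qed (simp add: layer_def)
      have 2: "of_bool (int (card y) = s - 2) * (\<Sum>e | e \<subseteq> ?V \<and> card e = 2. sgn_prod M (y \<union> e)) =
          up (length M) (int D - s) * layer D M (s - 2) y"
      proof (cases "int (card y) = s - 2")
        case True
        then have "of_nat (card y) = (of_int s - 2 :: complex)" by (metis of_int_of_nat_eq of_int_diff of_int_numeral)
        with upw True y show ?thesis by (simp add: layer_def up_def field_simps)
      qed (simp add: layer_def)
      show ?thesis using 1 2 by simp
    qed
    finally show ?thesis .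
  qed
qed

subsection \<open>Layers span\<close>

text \<open>A tensor product: the signed factors on the edges and the basis vector of
  \<open>S\<close> on the unmatched points. With the empty matching it is the standard basis vector
  of \<open>S\<close>, so this family joins the layers to the standard basis.\<close>

definition filled_layer :: "nat \<Rightarrow> (nat \<times> nat) list \<Rightarrow> nat set \<Rightarrow> nat set \<Rightarrow> complex" where
  "filled_layer D M S y = (if y \<in> Xs D \<and> y \<inter> ({..<D} - verts M) = S then sgn_prod M y else 0)"

text \<open>The factor of the new edge (a, b) is +1 where only a lies in \<open>y\<close> and -1
  where only b does; these cases are the two fillings on the right.\<close>

lemma filled_layer_swap:
  assumes "S \<subseteq> {..<D} - verts M" "a \<in> S" "b \<in> {..<D} - verts M" "b \<notin> S"
  shows "filled_layer D ((a, b) # M) (S - {a}) y =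
    filled_layer D M S y - filled_layer D M (insert b (S - {a})) y"
proof (cases "y \<in> Xs D")
  case True
  have R: "{..<D} - verts ((a, b) # M) = ({..<D} - verts M) - {a, b}" by auto
  let ?R = "{..<D} - verts M"
  have ab: "a \<noteq> b" "a \<in> ?R" using assms by auto
  consider "a \<in> y" "b \<notin> y" | "a \<notin> y" "b \<in> y" | "a \<in> y" "b \<in> y" | "a \<notin> y" "b \<notin> y" by blast
  then show ?thesis
  proof cases
    case 1
    have "y \<inter> (?R - {a, b}) = S - {a} \<longleftrightarrow> y \<inter> ?R = S" using assms 1 ab by blast
    moreover have "y \<inter> ?R \<noteq> insert b (S - {a})" using assms 1 ab by blast
    ultimately show ?thesis using 1 True unfolding filled_layer_def R by simp
  next
    case 2
    have "y \<inter> (?R - {a, b}) = S - {a} \<longleftrightarrow> y \<inter> ?R = insert b (S - {a})" using assms 2 ab by blast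
    moreover have "y \<inter> ?R \<noteq> S" using assms 2 ab by blast
    ultimately show ?thesis using 2 True unfolding filled_layer_def R by simp
  next
    case 3
    have "y \<inter> ?R \<noteq> insert b (S - {a})" "y \<inter> ?R \<noteq> S" using assms 3 ab by blast+
    then show ?thesis using 3 True unfolding filled_layer_def R by simp
  next
    case 4
    have "y \<inter> ?R \<noteq> insert b (S - {a})" "y \<inter> ?R \<noteq> S" using assms 4 ab by blast+
    then show ?thesis using 4 True unfolding filled_layer_def R by simp
  qed
qed (simp add: filled_layer_def)

text \<open>Each \<open>y\<close> has exactly one trace on the unmatched points, and on the support
  of \<open>sgn_prod M\<close> its size is the size of this trace plus the number of edges.\<close>

lemma sum_filled_layer:
  assumes "matching D M"
  shows "(\<Sum>S | S \<subseteq> {..<D} - verts M \<and> card S = k. filled_layer D M S y) =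
    layer D M (int (length M + k)) y"
proof (cases "y \<in> Xs D \<and> sgn_prod M y \<noteq> 0")
  case True
  let ?R = "{..<D} - verts M"
  have fin: "finite {S. S \<subseteq> ?R \<and> card S = k}" by (rule finite_subset[of _ "Pow ?R"]) auto
  have "(\<Sum>S | S \<subseteq> ?R \<and> card S = k. filled_layer D M S y) =
     (\<Sum>S | S \<subseteq> ?R \<and> card S = k. if S = y \<inter> ?R then sgn_prod M y else 0)"
    using True by (intro sum.cong) (auto simp: filled_layer_def)
  also have "\<dots> = (if card (y \<inter> ?R) = k then sgn_prod M y else 0)" using fin by simp
  also have "\<dots> = layer D M (int (length M + k)) y"
    using True card_eq_length_plus_rest[OF assms, of y] by (auto simp: layer_def Xs_def)
  finally show ?thesis .
next
  case False
  then have "filled_layer D M S y = 0" for S by (auto simp: filled_layer_def)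
  then show ?thesis using False by (auto simp: layer_def)
qed

text \<open>Two fillings of the same size differ by filled layers of matchings with one more edge, and
  their average is a layer; so downward induction on the size of the matching shows that the
  layers span.\<close>

lemma layers_span:
  assumes add: "\<And>u v. K u \<Longrightarrow> K v \<Longrightarrow> K (\<lambda>y. u y + v y)"
    and smult: "\<And>c u. K u \<Longrightarrow> K (\<lambda>y. c * u y)"
    and layer: "\<And>M s. matching D M \<Longrightarrow> K (layer D M s)"
    and M: "matching D M" and S: "S \<subseteq> {..<D} - verts M"
  shows "K (filled_layer D M S)"
  using M S
proof (induction "card ({..<D} - verts M)" arbitrary: M S rule: less_induct)
  case less
  let ?R = "{..<D} - verts M"
  have K0: "K (\<lambda>y. 0)" using smult[OF layer[OF less.prems(1)], of 0] by simp
  have Ksum: "finite T \<Longrightarrow> (\<And>t. t \<in> T \<Longrightarrow> K (u t)) \<Longrightarrow> K (\<lambda>y. \<Sum>t\<in>T. u t y)" for T :: "nat set set" and u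
    by (induction T rule: finite_induct) (auto simp: K0 intro!: add)
  have swap: "K (\<lambda>y. filled_layer D M S y - filled_layer D M (insert b (S - {a})) y)"
    if "S \<subseteq> ?R" "a \<in> S" "b \<in> ?R" "b \<notin> S" for S a b
  proof -
    have ab: "a \<in> ?R" "b \<in> ?R" "a \<noteq> b" using that by auto
    then have "matching D ((a, b) # M)" using less.prems by (auto simp: matching_Cons)
    moreover have "{..<D} - verts ((a, b) # M) \<subset> ?R" using ab by auto
    then have "card ({..<D} - verts ((a, b) # M)) < card ?R" by (intro psubset_card_mono) auto
    moreover have "S - {a} \<subseteq> {..<D} - verts ((a, b) # M)" using that by auto
    ultimately have "K (filled_layer D ((a, b) # M) (S - {a}))" using less.hyps by blast
    moreover have "filled_layer D ((a, b) # M) (S - {a}) =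
        (\<lambda>y. filled_layer D M S y - filled_layer D M (insert b (S - {a})) y)"
      using filled_layer_swap[OF that] by (rule ext)
    ultimately show ?thesis by simp
  qed
  \<comment> \<open>One element at a time is exchanged, moving the first filling towards the second;
    each exchange is an instance of \<open>swap\<close>.\<close>
  have diff: "K (\<lambda>y. filled_layer D M S y - filled_layer D M S' y)"
    if "S \<subseteq> ?R" "S' \<subseteq> ?R" "card S = card S'" for S S'
    using that
  proof (induction "card (S - S')" arbitrary: S rule: less_induct)
    case inner: less
    have fin: "finite S" "finite S'" using inner.prems finite_subset[of _ ?R] by auto
    show ?case
    proof (cases "S \<subseteq> S'")
      case True
      then have "S = S'" using inner.prems fin by (simp add: card_subset_eq)
      then show ?thesis using K0 by simp
    next
      case False
      then obtain a where a: "a \<in> S" "a \<notin> S'" by blast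
      have "\<not> S' \<subseteq> S" using False inner.prems fin card_subset_eq[of S S'] by auto
      then obtain b where b: "b \<in> S'" "b \<notin> S" by blast
      let ?S1 = "insert b (S - {a})"
      have "?S1 - S' \<subset> S - S'" using a b by auto
      then have "card (?S1 - S') < card (S - S')" using fin by (intro psubset_card_mono) auto
      moreover have "?S1 \<subseteq> ?R" using inner.prems b by auto
      moreover have "card ?S1 = card S'" using a b fin inner.prems card_Suc_Diff1[OF fin(1) a(1)] by simp
      ultimately have "K (\<lambda>y. filled_layer D M ?S1 y - filled_layer D M S' y)"
        using inner.hyps inner.prems by blast
      moreover have "K (\<lambda>y. filled_layer D M S y - filled_layer D M ?S1 y)"
        using a b inner.prems by (intro swap) auto
      ultimately show ?thesis using add by fastforce
    qed
  qed
  let ?T = "{S'. S' \<subseteq> ?R \<and> card S' = card S}"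
  have fin: "finite ?T" by (rule finite_subset[of _ "Pow ?R"]) auto
  have card_T: "of_nat (card ?T) \<noteq> (0 :: complex)" using less.prems fin by auto
  have "K (\<lambda>y. \<Sum>S'\<in>?T. filled_layer D M S y - filled_layer D M S' y)"
    using fin less.prems by (intro Ksum diff) auto
  then have "K (\<lambda>y. (\<Sum>S'\<in>?T. filled_layer D M S y - filled_layer D M S' y)
      + layer D M (int (length M + card S)) y)"
    using add layer[OF less.prems(1)] by blast
  then have "K (\<lambda>y. of_nat (card ?T) * filled_layer D M S y)"
    unfolding sum_subtractf sum_filled_layer[OF less.prems(1)] by simp
  from smult[OF this, of "inverse (of_nat (card ?T))"]
  show ?case unfolding mult.assoc[symmetric] left_inverse[OF card_T] by simp
qed

section \<open>Symmetry under complementation, and layers detecting zero\<close>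

lemma Ralg_support: "A \<in> Ralg D \<Longrightarrow> y \<notin> Xs D \<or> x \<notin> Xs D \<Longrightarrow> A y x = 0"
  by (induction arbitrary: x y rule: Ralg.induct)
     (auto simp: A2J_def A2Jbar_def A2star_def mid_def madd_def msmult_def mmul_def)

lemma sum_compl_Xs: "(\<Sum>z\<in>Xs D. u ({..<D} - z)) = (\<Sum>z\<in>Xs D. u z)"
  by (rule sum.reindex_bij_witness[of _ "\<lambda>z. {..<D} - z" "\<lambda>z. {..<D} - z"])
     (auto simp: Xs_def double_diff)

text \<open>Complementing both sets preserves their symmetric difference and only negates D - 2|x|,
  which enters squared. Products inherit the symmetry by reindexing the inner sum.\<close>

lemma Ralg_compl:
  assumes "A \<in> Ralg D" "x \<in> Xs D" "y \<in> Xs D"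
  shows "A ({..<D} - y) ({..<D} - x) = A y x"
  using assms
proof (induction arbitrary: x y rule: Ralg.induct)
  have mem: "{..<D} - x \<in> Xs D" for x by (auto simp: Xs_def)
  have sd: "({..<D} - x - ({..<D} - y)) \<union> ({..<D} - y - ({..<D} - x)) = (x - y) \<union> (y - x)"
    if "x \<in> Xs D" "y \<in> Xs D" for x y using that by (auto simp: Xs_def)
  have card: "card ({..<D} - x) = D - card x" if "x \<in> Xs D" for x
    using that Xs_finite[OF that] by (auto simp: Xs_def card_Diff_subset)
  have ceq: "card ({..<D} - y) = card ({..<D} - x) \<longleftrightarrow> card y = card x"
    if "x \<in> Xs D" "y \<in> Xs D" for x y
    using that Xs_card_le card by (metis diff_diff_cancel)
  have eq: "{..<D} - y = {..<D} - x \<longleftrightarrow> y = x" if "x \<in> Xs D" "y \<in> Xs D" for x y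
    using that by (auto simp: Xs_def)
  {
    case gen_J
    then show ?case using mem by (simp add: A2J_def sd ceq)
  next
    case gen_Jbar
    then show ?case using mem by (simp add: A2Jbar_def sd ceq)
  next
    case gen_star
    have "(int D - 2 * int (D - card x))\<^sup>2 = (int D - 2 * int (card x))\<^sup>2"
      using Xs_card_le[OF gen_star(1)] by (simp add: of_nat_diff power2_eq_square algebra_simps)
    then show ?case using gen_star mem by (simp add: A2star_def eq card)
  next
    case unit
    then show ?case using mem by (simp add: mid_def eq)
  next
    case (mult A B)
    have "(\<Sum>z\<in>Xs D. A ({..<D} - y) z * B z ({..<D} - x)) =
        (\<Sum>z\<in>Xs D. A ({..<D} - y) ({..<D} - z) * B ({..<D} - z) ({..<D} - x))"
      using sum_compl_Xs[of "\<lambda>z. A ({..<D} - y) z * B z ({..<D} - x)" D] by simp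
    also have "\<dots> = (\<Sum>z\<in>Xs D. A y z * B z x)" using mult by (intro sum.cong) auto
    finally show ?case using mult.prems mem by (simp add: mmul_def)
  }
qed (simp_all add: madd_def msmult_def)

text \<open>Complementation sends a layer to the reflected layer up to sign. For odd
  \<open>D\<close> this recovers the levels of the parity that the labels leave out.\<close>

lemma app_layer_compl:
  assumes "A \<in> Ralg D" "matching D M" "y \<in> Xs D"
  shows "app D A (layer D M (int D - s)) y = (-1) ^ length M * app D A (layer D M s) ({..<D} - y)"
proof -
  have l: "layer D M s ({..<D} - z) = (-1) ^ length M * layer D M (int D - s) z" if z: "z \<in> Xs D" for z
  proof -
    have "card ({..<D} - z) = D - card z" "card z \<le> D"
      using z Xs_finite[OF z] Xs_card_le[OF z] by (auto simp: Xs_def card_Diff_subset)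
    then have "int (card ({..<D} - z)) = s \<longleftrightarrow> int (card z) = int D - s" by auto
    moreover have "{..<D} - z \<in> Xs D" by (auto simp: Xs_def)
    ultimately show ?thesis using z by (auto simp: layer_def sgn_prod_compl[OF assms(2)])
  qed
  have "app D A (layer D M s) ({..<D} - y) =
     (\<Sum>z\<in>Xs D. A ({..<D} - y) ({..<D} - z) * layer D M s ({..<D} - z))"
    unfolding app_def by (rule sum_compl_Xs[symmetric])
  also have "\<dots> = (\<Sum>z\<in>Xs D. A y z * ((-1) ^ length M * layer D M (int D - s) z))"
    using assms by (intro sum.cong) (auto simp: Ralg_compl l)
  also have "\<dots> = (-1) ^ length M * app D A (layer D M (int D - s)) y"
    by (simp add: app_def sum_distrib_left mult_ac)
  finally show ?thesis by (simp flip: mult.assoc power_add mult_2)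
qed

lemma app_zero_imp_zero:
  assumes A: "A \<in> Ralg D" and kill: "\<And>M s. matching D M \<Longrightarrow> app D A (layer D M s) = (\<lambda>y. 0)"
  shows "A = (\<lambda>y x. 0)"
proof (intro ext)
  fix y x
  show "A y x = 0"
  proof (cases "x \<in> Xs D")
    case True
    \<comment> \<open>This is the basis vector of x. The vectors killed by \<open>A\<close> form a
      subspace containing all layers, so \<open>layers_span\<close> applies.\<close>
    have "app D A (filled_layer D [] x) = (\<lambda>y. 0)"
    proof (rule layers_span[where K = "\<lambda>v. app D A v = (\<lambda>y. 0)"])
      fix u v assume "app D A u = (\<lambda>y. 0)" "app D A v = (\<lambda>y. 0)"
      then show "app D A (\<lambda>y. u y + v y) = (\<lambda>y. 0)"
        by (simp add: app_def fun_eq_iff distrib_left sum.distrib)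
    next
      fix c u assume *: "app D A u = (\<lambda>y. 0)"
      have "app D A (\<lambda>y. c * u y) = (\<lambda>y. c * app D A u y)"
        by (simp add: app_def fun_eq_iff sum_distrib_left mult_ac)
      then show "app D A (\<lambda>y. c * u y) = (\<lambda>y. 0)" using * by simp
    qed (use True kill in \<open>auto simp: Xs_def\<close>)
    moreover have "app D A (filled_layer D [] x) y = (\<Sum>z\<in>Xs D. if z = x then A y x else 0)"
      unfolding app_def by (intro sum.cong) (auto simp: filled_layer_def Xs_def Int_absorb2)
    ultimately show ?thesis using True by (simp add: fun_eq_iff)
  qed (use Ralg_support[OF A] in auto)
qed

subsection \<open>The irreducible parts\<close>

text \<open>The part labelled \<open>(m, t)\<close> belongs to the matchings with \<open>m\<close> edges. For odd \<open>D\<close> only \<open>t = 0\<close>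
  occurs. For even \<open>D\<close> the weights \<open>H\<close> are \<open>0\<close> mod 4 if \<open>t \<in> {0, 1}\<close> and \<open>2\<close> mod 4 if
  \<open>t \<in> {2, 3}\<close>, and the sign under \<open>s \<mapsto> D - s\<close> is \<open>+\<close> for even \<open>t\<close> and \<open>-\<close> for odd \<open>t\<close>. Some parts
  are zero.\<close>

definition Labels :: "nat \<Rightarrow> (nat \<times> nat) set" where
  "Labels D = (if odd D then {..D div 2} \<times> {0} else {..D div 2} \<times> {..<4})"

text \<open>A part uses the levels \<open>top_level\<close>, \<open>top_level\<close> - 2, and so on
  down to at least the number of edges. For odd \<open>D\<close> these have the parity of that
  number. For even \<open>D\<close> they start at or just below the middle; label 1 starts two below
  it, because an antisymmetric combination vanishes at the middle.\<close>

definition top_level :: "nat \<Rightarrow> nat \<times> nat \<Rightarrow> int" where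
  "top_level D l = (if odd D then int D - int (fst l) - 1
     else int (D div 2) - (if snd l = 0 then 0 else if snd l = 1 then 2 else 1))"

text \<open>The value 0 for odd \<open>D\<close> makes \<open>bvec\<close> a single layer.\<close>

definition refl_sign :: "nat \<Rightarrow> nat \<times> nat \<Rightarrow> complex" where
  "refl_sign D l = (if odd D then 0 else if snd l = 0 \<or> snd l = 2 then 1 else -1)"

text \<open>For an empty part the quotient is 0.\<close>

definition bsize :: "nat \<Rightarrow> nat \<times> nat \<Rightarrow> nat" where
  "bsize D l = nat ((top_level D l - int (fst l) + 2) div 2)"

definition bvec :: "nat \<Rightarrow> nat \<times> nat \<Rightarrow> (nat \<times> nat) list \<Rightarrow> int \<Rightarrow> nat set \<Rightarrow> complex" where
  "bvec D l M j y = layer D M (top_level D l - 2 * j) y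
     + refl_sign D l * layer D M (int D - top_level D l + 2 * j) y"

text \<open>The recurrence that \<open>E\<^sup>2 + F\<^sup>2\<close> satisfies on the basis vectors steps out of range at index 0;
  there \<open>v\<^sub>-\<^sub>1 = turn * v\<^sub>1 + loop * v\<^sub>0\<close>.\<close>

definition bvec_turn :: "nat \<Rightarrow> nat \<times> nat \<Rightarrow> complex" where
  "bvec_turn D l = (if even D \<and> snd l = 0 then 1 else 0)"

definition bvec_loop :: "nat \<Rightarrow> nat \<times> nat \<Rightarrow> complex" where
  "bvec_loop D l = (if even D \<and> snd l = 2 then 1 else if even D \<and> snd l = 3 then -1 else 0)"

lemma finite_Labels [simp]: "finite (Labels D)"
  by (simp add: Labels_def)

lemma Labels_le: "l \<in> Labels D \<Longrightarrow> 2 * fst l \<le> D"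
  by (auto simp: Labels_def split: if_splits)

lemma int_half: "even D \<Longrightarrow> 2 * int (D div 2) = int D"
  by (metis dvd_mult_div_cancel of_nat_mult of_nat_numeral)

lemma less_bsize_iff: "j < bsize D l \<longleftrightarrow> int (fst l) \<le> top_level D l - 2 * int j"
  unfolding bsize_def by linarith

lemma top_level_le:
  assumes "l \<in> Labels D"
  shows "top_level D l \<le> int D - int (fst l)"
proof -
  have "2 * int (fst l) \<le> int D" using Labels_le[OF assms] by linarith
  then show ?thesis using int_half[of D] by (auto simp: top_level_def split: if_splits)
qed

text \<open>For odd \<open>D\<close> the level above the top lies outside the support range. For
  even \<open>D\<close> one step past the start is reflected at the middle: it lands on index 1, on
  zero, or on plus or minus index 0, for labels 0, 1, 2 and 3 respectively.\<close>

lemma bvec_minus_1: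
  assumes "l \<in> Labels D" "matching D M" "length M = fst l"
  shows "bvec D l M (-1) y = bvec_turn D l * bvec D l M 1 y + bvec_loop D l * bvec D l M 0 y"
proof (cases "odd D")
  case True
  have "layer D M (top_level D l + 2) y = 0"
    using assms True by (intro layer_eq_0) (auto simp: top_level_def)
  then show ?thesis using True by (simp add: bvec_def refl_sign_def bvec_turn_def bvec_loop_def)
next
  case False
  then have D: "int D = 2 * int (D div 2)" using int_half by simp
  have "snd l \<in> {0, 1, 2, 3}" using assms(1) False by (auto simp: Labels_def)
  then consider "snd l = 0" | "snd l = 1" | "snd l = 2" | "snd l = 3" by auto
  then show ?thesis
    using False
    by cases (simp_all add: bvec_def refl_sign_def bvec_turn_def bvec_loop_def top_level_def D add.commute)
qed

lemma bvec_bsize: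
  assumes "l \<in> Labels D" "matching D M" "length M = fst l"
  shows "bvec D l M (int (bsize D l)) y = 0"
proof -
  have 1: "top_level D l - 2 * int (bsize D l) < int (fst l)" using less_bsize_iff[of "bsize D l" D l] by simp
  then have "layer D M (top_level D l - 2 * int (bsize D l)) y = 0"
     "layer D M (int D - top_level D l + 2 * int (bsize D l)) y = 0"
    using assms by (auto intro!: layer_eq_0)
  then show ?thesis by (simp add: bvec_def)
qed

lemma app_add_vec: "app D A (\<lambda>y. u y + v y) = (\<lambda>y. app D A u y + app D A v y)"
  by (simp add: app_def fun_eq_iff distrib_left sum.distrib)

lemma app_smult_vec: "app D A (\<lambda>y. c * u y) = (\<lambda>y. c * app D A u y)"
  by (simp add: app_def fun_eq_iff sum_distrib_left mult_ac)

lemma app_sum_vec: "app D A (\<lambda>y. \<Sum>i\<in>I. u i y) = (\<lambda>y. \<Sum>i\<in>I. app D A (u i) y)"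
  unfolding app_def fun_eq_iff sum_distrib_left by (subst sum.swap) simp

lemma app_bvec:
  "app D A (bvec D l M j) = (\<lambda>y. app D A (layer D M (top_level D l - 2 * j)) y
     + refl_sign D l * app D A (layer D M (int D - top_level D l + 2 * j)) y)"
proof -
  have "bvec D l M j = (\<lambda>y. layer D M (top_level D l - 2 * j) y
     + refl_sign D l * layer D M (int D - top_level D l + 2 * j) y)" by (simp add: bvec_def fun_eq_iff)
  then show ?thesis by (simp add: app_add_vec app_smult_vec)
qed

text \<open>\<open>lam\<close> and \<open>theta\<close> are the eigenvalues of \<open>A2J\<close>
  and \<open>A2star\<close>. Both are invariant under reflecting the level, so both summands of
  \<open>bvec\<close> share them.\<close>

definition lam :: "nat \<Rightarrow> nat \<times> nat \<Rightarrow> nat \<Rightarrow> complex" where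
  "lam D l j = of_int ((top_level D l - 2 * int j) * (int D - (top_level D l - 2 * int j))
     - int (fst l) * (int D + 1 - int (fst l)))"

definition theta :: "nat \<Rightarrow> nat \<times> nat \<Rightarrow> nat \<Rightarrow> complex" where
  "theta D l j = of_int ((int D - 2 * (top_level D l - 2 * int j))\<^sup>2 - int D) / 2"

lemma app_A2J_bvec:
  assumes "matching D M" "length M = fst l"
  shows "app D (A2J D) (bvec D l M (int j)) = (\<lambda>y. lam D l j * bvec D l M (int j) y)"
  unfolding app_bvec app_A2J[OF assms(1)] using assms(2)
  by (auto simp: fun_eq_iff bvec_def lam_def algebra_simps)

lemma app_A2star_bvec:
  "app D (A2star D) (bvec D l M (int j)) = (\<lambda>y. theta D l j * bvec D l M (int j) y)"
proof -
  have "(int D - 2 * (int D - top_level D l + 2 * int j))\<^sup>2 = (int D - 2 * (top_level D l - 2 * int j))\<^sup>2"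
    by (simp add: power2_eq_square algebra_simps)
  then show ?thesis
    unfolding app_bvec app_A2star by (simp add: fun_eq_iff bvec_def theta_def algebra_simps)
qed

text \<open>Raising from a level and lowering from the reflected level have the same coefficient, so
  the symmetrised vectors satisfy the recurrence of single layers.\<close>

lemma app_A2Jbar_bvec:
  assumes "matching D M" "length M = fst l"
  shows "app D (A2Jbar D) (bvec D l M j) = (\<lambda>y. up (fst l) (top_level D l - 2 * j) * bvec D l M (j - 1) y
     + up (fst l) (int D - top_level D l + 2 * j) * bvec D l M (j + 1) y)"
proof -
  have e: "top_level D l - 2 * j + 2 = top_level D l - 2 * (j - 1)"
    "top_level D l - 2 * j - 2 = top_level D l - 2 * (j + 1)"
    "int D - top_level D l + 2 * j + 2 = int D - top_level D l + 2 * (j + 1)"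
    "int D - top_level D l + 2 * j - 2 = int D - top_level D l + 2 * (j - 1)"
    "int D - (int D - top_level D l + 2 * j) = top_level D l - 2 * j"
    "int D - (top_level D l - 2 * j) = int D - top_level D l + 2 * j" by auto
  show ?thesis
    unfolding app_bvec app_A2Jbar[OF assms(1)] e assms(2) bvec_def
    by (simp add: fun_eq_iff distrib_left mult_ac)
qed

section \<open>Matrices of the algebra on the parts\<close>

type_synonym lmat = "nat \<times> nat \<Rightarrow> nat \<Rightarrow> nat \<Rightarrow> complex"

definition in_block :: "nat \<Rightarrow> nat \<times> nat \<Rightarrow> nat \<Rightarrow> nat \<Rightarrow> bool" where
  "in_block D l j k \<longleftrightarrow> l \<in> Labels D \<and> j < bsize D l \<and> k < bsize D l"

text \<open>One family \<open>r\<close> serves all matchings with the same number of edges, since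
  their modules are isomorphic copies. Entries outside the blocks are fixed to zero so that
  \<open>A\<close> determines \<open>r\<close>.\<close>

definition acts :: "nat \<Rightarrow> cmat \<Rightarrow> lmat \<Rightarrow> bool" where
  "acts D A r \<longleftrightarrow> (\<forall>l j k. \<not> in_block D l j k \<longrightarrow> r l j k = 0) \<and>
     (\<forall>l\<in>Labels D. \<forall>M. matching D M \<longrightarrow> length M = fst l \<longrightarrow> (\<forall>k<bsize D l.
        app D A (bvec D l M (int k)) = (\<lambda>y. \<Sum>j<bsize D l. r l j k * bvec D l M (int j) y)))"

definition ldiag :: "nat \<Rightarrow> (nat \<times> nat \<Rightarrow> nat \<Rightarrow> complex) \<Rightarrow> lmat" where
  "ldiag D \<phi> l j k = (if in_block D l j k \<and> j = k then \<phi> l j else 0)"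

definition lmul :: "nat \<Rightarrow> lmat \<Rightarrow> lmat \<Rightarrow> lmat" where
  "lmul D r r' l j k = (if in_block D l j k then \<Sum>i<bsize D l. r l j i * r' l i k else 0)"

text \<open>The tridiagonal matrix of \<open>A2Jbar\<close>. The two corrections in column 0 come
  from rewriting the vector of index -1 by \<open>bvec_minus_1\<close>.\<close>

definition ltri :: "nat \<Rightarrow> lmat" where
  "ltri D l j k = (if in_block D l j k then
      (if j = Suc k then up (fst l) (int D - top_level D l + 2 * int k)
           + (if k = 0 then bvec_turn D l * up (fst l) (top_level D l) else 0)
       else if k = Suc j then up (fst l) (top_level D l - 2 * int k)
       else if j = 0 \<and> k = 0 then bvec_loop D l * up (fst l) (top_level D l) else 0) else 0)"

lemma acts_support: "acts D A r \<Longrightarrow> \<not> in_block D l j k \<Longrightarrow> r l j k = 0"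
  unfolding acts_def by blast

lemma acts_ldiag:
  assumes "\<And>l M k. l \<in> Labels D \<Longrightarrow> matching D M \<Longrightarrow> length M = fst l \<Longrightarrow>
     app D A (bvec D l M (int k)) = (\<lambda>y. \<phi> l k * bvec D l M (int k) y)"
  shows "acts D A (ldiag D \<phi>)"
  unfolding acts_def
proof (intro conjI allI ballI impI)
  fix l M k assume *: "l \<in> Labels D" "matching D M" "length M = fst l" "k < bsize D l"
  have "(\<Sum>j<bsize D l. ldiag D \<phi> l j k * bvec D l M (int j) y) =
      (\<Sum>j<bsize D l. if j = k then \<phi> l k * bvec D l M (int k) y else 0)" for y
    using * by (intro sum.cong) (auto simp: ldiag_def in_block_def)
  then show "app D A (bvec D l M (int k)) = (\<lambda>y. \<Sum>j<bsize D l. ldiag D \<phi> l j k * bvec D l M (int j) y)"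
    using * assms by simp
qed (simp add: ldiag_def)

lemma acts_A2J: "acts D (A2J D) (ldiag D (lam D))"
  by (rule acts_ldiag) (rule app_A2J_bvec)

lemma acts_A2star: "acts D (A2star D) (ldiag D (theta D))"
  by (rule acts_ldiag) (rule app_A2star_bvec)

lemma acts_mid: "acts D (mid D) (ldiag D (\<lambda>l j. 1))"
proof (rule acts_ldiag)
  fix l M k
  have "app D (mid D) (bvec D l M (int k)) y = (\<Sum>z\<in>Xs D. if z = y then bvec D l M (int k) y else 0)" for y
    unfolding app_def by (intro sum.cong) (auto simp: mid_def)
  then show "app D (mid D) (bvec D l M (int k)) = (\<lambda>y. 1 * bvec D l M (int k) y)"
    by (auto simp: fun_eq_iff bvec_def layer_def)
qed

lemma acts_A2Jbar: "acts D (A2Jbar D) (ltri D)"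
  unfolding acts_def
proof (intro conjI allI ballI impI)
  fix l M k assume *: "l \<in> Labels D" "matching D M" "length M = fst l" "k < bsize D l"
  let ?a = "top_level D l" and ?m = "fst l" and ?d = "bsize D l"
  let ?v = "bvec D l M"
  show "app D (A2Jbar D) (?v (int k)) = (\<lambda>y. \<Sum>j<?d. ltri D l j k * ?v (int j) y)"
  proof
    fix y
    let ?c = "up ?m (int D - ?a + 2 * int k) + (if k = 0 then bvec_turn D l * up ?m ?a else 0)"
    \<comment> \<open>For k = 0 the index \<open>k - 1\<close> truncates to 0; the guard k > 0
      removes that term.\<close>
    have "(\<Sum>j<?d. ltri D l j k * ?v (int j) y) =
       (\<Sum>j<?d. (if j = Suc k then ?c * ?v (int (Suc k)) y else 0)
          + (if j = k - 1 then (if k > 0 then up ?m (?a - 2 * int k) * ?v (int (k - 1)) y else 0) else 0)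
          + (if j = 0 then (if k = 0 then bvec_loop D l * up ?m ?a * ?v 0 y else 0) else 0))"
      using * by (intro sum.cong refl) (auto simp: ltri_def in_block_def)
    also have "\<dots> = (if Suc k < ?d then ?c * ?v (int (Suc k)) y else 0)
       + (if k > 0 then up ?m (?a - 2 * int k) * ?v (int (k - 1)) y else 0)
       + (if k = 0 then bvec_loop D l * up ?m ?a * ?v 0 y else 0)"
      using * by (simp add: sum.distrib)
    \<comment> \<open>In the last column the term of index \<open>Suc k\<close> is missing from the
      sum, but its vector is zero.\<close>
    also have "(if Suc k < ?d then ?c * ?v (int (Suc k)) y else 0) = ?c * ?v (int (Suc k)) y"
    proof (cases "Suc k < ?d")
      case False
      then have "Suc k = ?d" using * by simp
      then have "?v (int (Suc k)) y = 0" using bvec_bsize[OF *(1-3)] by simp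
      then show ?thesis by simp
    qed simp
    finally have "(\<Sum>j<?d. ltri D l j k * ?v (int j) y) = ?c * ?v (int (Suc k)) y
       + (if k > 0 then up ?m (?a - 2 * int k) * ?v (int (k - 1)) y else 0)
       + (if k = 0 then bvec_loop D l * up ?m ?a * ?v 0 y else 0)" .
    then show "app D (A2Jbar D) (?v (int k)) y = (\<Sum>j<?d. ltri D l j k * ?v (int j) y)"
      unfolding app_A2Jbar_bvec[OF *(2,3)]
      using bvec_minus_1[OF *(1-3)]
      by (cases "k = 0") (auto simp: algebra_simps of_nat_diff)
  qed
qed (simp add: ltri_def)

lemma acts_madd:
  assumes "acts D A r" "acts D B s"
  shows "acts D (madd A B) (\<lambda>l j k. r l j k + s l j k)"
proof -
  have "app D (madd A B) v = (\<lambda>y. app D A v y + app D B v y)" for v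
    by (simp add: app_def madd_def fun_eq_iff distrib_right sum.distrib)
  then show ?thesis using assms unfolding acts_def by (simp add: distrib_right sum.distrib)
qed

lemma acts_msmult:
  assumes "acts D A r"
  shows "acts D (msmult c A) (\<lambda>l j k. c * r l j k)"
proof -
  have "app D (msmult c A) v = (\<lambda>y. c * app D A v y)" for v
    by (simp add: app_def msmult_def fun_eq_iff sum_distrib_left mult_ac)
  then show ?thesis using assms unfolding acts_def by (simp add: sum_distrib_left mult.assoc)
qed

lemma app_mmul:
  assumes "A \<in> Ralg D"
  shows "app D (mmul D A B) v = app D A (app D B v)"
proof
  fix y
  show "app D (mmul D A B) v y = app D A (app D B v) y"
  proof (cases "y \<in> Xs D")
    case True
    have "app D (mmul D A B) v y = (\<Sum>x\<in>Xs D. \<Sum>z\<in>Xs D. A y z * B z x * v x)"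
      unfolding app_def using True by (intro sum.cong) (auto simp: mmul_def sum_distrib_right)
    also have "\<dots> = app D A (app D B v) y"
      unfolding app_def by (subst sum.swap) (simp add: sum_distrib_left mult.assoc)
    finally show ?thesis .
  next
    case False
    then show ?thesis using Ralg_support[OF assms] by (simp add: app_def mmul_def)
  qed
qed

lemma acts_mmul:
  assumes "A \<in> Ralg D" "acts D A r" "acts D B s"
  shows "acts D (mmul D A B) (lmul D r s)"
  unfolding acts_def
proof (intro conjI allI ballI impI)
  fix l M k assume *: "l \<in> Labels D" "matching D M" "length M = fst l" "k < bsize D l"
  let ?d = "bsize D l" and ?v = "bvec D l M"
  have "app D (mmul D A B) (?v (int k)) = app D A (\<lambda>y. \<Sum>i<?d. s l i k * ?v (int i) y)"
    using assms * by (simp add: app_mmul acts_def)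
  also have "\<dots> = (\<lambda>y. \<Sum>i<?d. s l i k * app D A (?v (int i)) y)"
    by (simp add: app_sum_vec app_smult_vec)
  also have "\<dots> = (\<lambda>y. \<Sum>i<?d. \<Sum>j<?d. s l i k * (r l j i * ?v (int j) y))"
    using assms(2) * by (simp add: acts_def sum_distrib_left)
  also have "\<dots> = (\<lambda>y. \<Sum>j<?d. \<Sum>i<?d. s l i k * (r l j i * ?v (int j) y))"
    by (subst sum.swap) simp
  also have "\<dots> = (\<lambda>y. \<Sum>j<?d. lmul D r s l j k * ?v (int j) y)"
    using * by (auto simp: lmul_def in_block_def sum_distrib_left sum_distrib_right mult_ac fun_eq_iff intro!: sum.cong)
  finally show "app D (mmul D A B) (?v (int k)) = \<dots>" .
qed (simp add: lmul_def)

lemma acts_exists: "A \<in> Ralg D \<Longrightarrow> \<exists>r. acts D A r"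
proof (induction rule: Ralg.induct)
  case (mult A B)
  then show ?case using acts_mmul by blast
qed (use acts_A2J acts_A2star acts_A2Jbar acts_mid acts_madd acts_msmult in blast)+

section \<open>Uniqueness of the matrices and faithfulness of the action\<close>

lemma matching_initial:
  assumes "2 * m \<le> D"
  shows "matching D (map (\<lambda>i. (i, m + i)) [0..<m])"
proof -
  have "map (\<lambda>i. i) [0..<m] @ map (\<lambda>i. m + i) [0..<m] = [0..<m] @ [m..<m + m]"
    by (simp add: map_add_upt[of m m, symmetric] add.commute)
  then have "distinct (map fst (map (\<lambda>i. (i, m + i)) [0..<m]) @ map snd (map (\<lambda>i. (i, m + i)) [0..<m]))"
    by (simp add: comp_def)
  then show ?thesis using assms by (auto simp: matching_def verts_def)
qed

lemma sgn_prod_eq_1: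
  "(\<And>a b. (a, b) \<in> set M \<Longrightarrow> a \<in> y \<and> b \<notin> y) \<Longrightarrow> sgn_prod M y = 1"
proof (induction M)
  case (Cons p M)
  then show ?case by (cases p) auto
qed simp

text \<open>Evaluation at a suitable set \<open>y\<close> separates one basis vector from the
  others, so coefficients in the basis can be read off.\<close>

lemma bvec_dual:
  assumes "l \<in> Labels D" "j < bsize D l"
  obtains M y where "matching D M" "length M = fst l" "bvec D l M (int j) y \<noteq> 0"
    "\<And>k. k \<noteq> j \<Longrightarrow> bvec D l M (int k) y = 0"
proof -
  let ?m = "fst l" and ?a = "top_level D l"
  define M where "M = map (\<lambda>i. (i, ?m + i)) [0..<?m]"
  define s where "s = nat (?a - 2 * int j)"
  have s: "int s = ?a - 2 * int j" "?m \<le> s" using assms(2) unfolding less_bsize_iff s_def by auto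
  have sD: "s + ?m \<le> D" using top_level_le[OF assms(1)] s by linarith
  \<comment> \<open>All first endpoints together with s - m unmatched points: the sign product is 1
    and the size is the level of index j.\<close>
  define y where "y = {..<?m} \<union> {2 * ?m..<?m + s}"
  have cy: "card y = s" unfolding y_def using s by (subst card_Un_disjoint) auto
  have y: "y \<in> Xs D" unfolding y_def Xs_def using sD s by auto
  have sg: "sgn_prod M y = 1" by (rule sgn_prod_eq_1) (auto simp: M_def y_def)
  have bv: "bvec D l M (int k) y = of_bool (k = j) + refl_sign D l * of_bool (int D - ?a + 2 * int k = int s)" for k
    using y cy sg s(1) by (auto simp: bvec_def layer_def)
  \<comment> \<open>The reflected summand reaches the size of \<open>y\<close> only at the middle
    level, where the sign is +1 and the two summands add up.\<close>
  have other: "refl_sign D l = 0 \<or> int D - ?a + 2 * int k \<noteq> int s \<or>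
     (k = j \<and> refl_sign D l = 1)" for k
  proof (cases "odd D")
    case True then show ?thesis by (simp add: refl_sign_def)
  next
    case False
    then have D: "int D = 2 * int (D div 2)" using int_half by simp
    show ?thesis using False D s(1) by (auto simp: refl_sign_def top_level_def)
  qed
  show ?thesis
  proof (rule that)
    show "matching D M" unfolding M_def using Labels_le[OF assms(1)] by (rule matching_initial)
    show "length M = fst l" by (simp add: M_def)
    show "bvec D l M (int j) y \<noteq> 0" using other[of j] by (auto simp: bv)
    show "bvec D l M (int k) y = 0" if "k \<noteq> j" for k using other[of k] that by (auto simp: bv)
  qed
qed

lemma acts_unique:
  assumes "acts D A r" "acts D A s"
  shows "r = s"
proof (intro ext)
  fix l j k
  show "r l j k = s l j k"
  proof (cases "in_block D l j k")
    case True
    then have l: "l \<in> Labels D" "j < bsize D l" "k < bsize D l" by (auto simp: in_block_def)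
    obtain M y where M: "matching D M" "length M = fst l" "bvec D l M (int j) y \<noteq> 0"
      "\<And>k. k \<noteq> j \<Longrightarrow> bvec D l M (int k) y = 0" by (rule bvec_dual[OF l(1,2)]) blast
    have "app D A (bvec D l M (int k)) y = t l j k * bvec D l M (int j) y" if "acts D A t" for t
    proof -
      have "app D A (bvec D l M (int k)) y = (\<Sum>i<bsize D l. t l i k * bvec D l M (int i) y)"
        using that l M by (simp add: acts_def)
      also have "\<dots> = (\<Sum>i<bsize D l. if i = j then t l j k * bvec D l M (int j) y else 0)"
        using M(4) by (intro sum.cong) auto
      finally show ?thesis using l by simp
    qed
    then show ?thesis using assms M(3) by (metis mult_right_cancel)
  qed (use assms in \<open>metis acts_support\<close>)
qed

text \<open>Every layer in range is recovered from the basis vectors of the parts: directly or by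
  complementation for odd \<open>D\<close>, from symmetric and antisymmetric combinations for even
  \<open>D\<close>.\<close>

lemma acts_zero_imp_zero:
  assumes A: "A \<in> Ralg D" and z: "acts D A (\<lambda>l j k. 0)"
  shows "A = (\<lambda>y x. 0)"
proof (rule app_zero_imp_zero[OF A])
  fix M s assume M: "matching D M"
  let ?m = "length M"
  have m: "2 * ?m \<le> D"
    using card_verts[OF M] card_mono[of "{..<D}" "verts M"] M by (simp add: matching_def)
  have kill: "app D A (bvec D (?m, t) M (int k)) = (\<lambda>y. 0)"
    if "(?m, t) \<in> Labels D" "k < bsize D (?m, t)" for t k
    using z that M by (simp add: acts_def)
  have out: "app D A (layer D M s) = (\<lambda>y. 0)" if "s < int ?m \<or> s > int D - int ?m"
    using layer_eq_0[OF M that] by (simp add: app_def fun_eq_iff)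
  show "app D A (layer D M s) = (\<lambda>y. 0)"
  proof (cases "odd D")
    case odd: True
    have lab: "(?m, 0) \<in> Labels D" using m odd by (auto simp: Labels_def)
    have half: "app D A (layer D M s) = (\<lambda>y. 0)" if s: "even (s - (int D - int ?m - 1))"
      "int ?m \<le> s" "s \<le> int D - int ?m" for s
    proof -
      have "s \<noteq> int D - int ?m" using s(1) by auto
      then have "s \<le> int D - int ?m - 1" using s by simp
      moreover obtain q where q: "s - (int D - int ?m - 1) = 2 * q" using s(1) by (rule evenE)
      ultimately have "s = int D - int ?m - 1 - 2 * int (nat (- q))" by simp
      then obtain k where k: "s = int D - int ?m - 1 - 2 * int k" by blast
      have "k < bsize D (?m, 0)" using s k odd unfolding less_bsize_iff by (simp add: top_level_def)
      from kill[OF lab this] show ?thesis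
        using odd k by (simp add: app_bvec top_level_def refl_sign_def)
    qed
    show ?thesis
    proof (cases "s < int ?m \<or> s > int D - int ?m")
      case False
      show ?thesis
      proof (cases "even (s - (int D - int ?m - 1))")
        case True then show ?thesis using half False by auto
      next
        case no: False
        \<comment> \<open>As \<open>D\<close> is odd, reflecting a level changes its parity, which
          brings it back to the case \<open>half\<close>.\<close>
        have "even (int D - s - (int D - int ?m - 1))" using no odd by auto
        then have h: "app D A (layer D M (int D - s)) = (\<lambda>y. 0)" using half False by auto
        show ?thesis
        proof
          fix y
          show "app D A (layer D M s) y = 0"
          proof (cases "y \<in> Xs D")
            case True
            then show ?thesis using app_layer_compl[OF A M True, of "int D - s"] h by simp
          qed (use Ralg_support[OF A] in \<open>simp add: app_def\<close>)
        qed
      qed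
    qed (rule out)
  next
    case False
    define N where "N = int (D div 2)"
    have D: "int D = 2 * N" using False int_half unfolding N_def by simp
    have lab: "(?m, t) \<in> Labels D" if "t < 4" for t using m False that by (auto simp: Labels_def)
    have sum: "app D A (layer D M (N - int p)) y + app D A (layer D M (N + int p)) y = 0"
      if p: "int p \<le> N - int ?m" for p y
    proof -
      \<comment> \<open>The parity of the distance p from the middle selects the symmetric part that
        contains the levels N - p and N + p.\<close>
      define t :: nat where "t = (if even p then 0 else 2)"
      have lev: "top_level D (?m, t) - 2 * int (p div 2) = N - int p"
        using False by (auto simp: top_level_def t_def N_def elim!: oddE)
      then have lev': "int D - top_level D (?m, t) + 2 * int (p div 2) = N + int p" using D by simp
      have b: "p div 2 < bsize D (?m, t)" unfolding less_bsize_iff lev using p by simp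
      have t: "t < 4" "refl_sign D (?m, t) = 1" using False by (auto simp: t_def refl_sign_def)
      from kill[OF lab[OF t(1)] b] show ?thesis
        unfolding app_bvec lev lev' t(2) by (simp add: fun_eq_iff)
    qed
    have diff: "app D A (layer D M (N - int p)) y - app D A (layer D M (N + int p)) y = 0"
      if p: "int p \<le> N - int ?m" for p y
    proof (cases "p = 0")
      case pos: False
      \<comment> \<open>The antisymmetric part starts at distance 2 for even p and at distance 1 for
        odd p, so the index is \<open>(p - 1) div 2\<close> in both cases.\<close>
      define t :: nat where "t = (if even p then 1 else 3)"
      obtain q where q: "p = 2 * q + 1 \<or> p = 2 * q + 2" using pos by (metis One_nat_def Suc_eq_plus1 add_2_eq_Suc' even_Suc evenE mult_Suc_right not0_implies_Suc oddE)
      then have lev: "top_level D (?m, t) - 2 * int ((p - 1) div 2) = N - int p"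
        using False by (auto simp: top_level_def t_def N_def)
      then have lev': "int D - top_level D (?m, t) + 2 * int ((p - 1) div 2) = N + int p" using D by simp
      have b: "(p - 1) div 2 < bsize D (?m, t)" unfolding less_bsize_iff lev using p by simp
      have t: "t < 4" "refl_sign D (?m, t) = -1" using False by (auto simp: t_def refl_sign_def)
      from kill[OF lab[OF t(1)] b] show ?thesis
        unfolding app_bvec lev lev' t(2) by (simp add: fun_eq_iff)
    qed simp
    have both: "app D A (layer D M (N - int p)) y = 0 \<and> app D A (layer D M (N + int p)) y = 0"
      if "int p \<le> N - int ?m" for p y
    proof -
      have "app D A (layer D M (N - int p)) y = app D A (layer D M (N + int p)) y"
        using diff[OF that] by simp
      then show ?thesis using sum[OF that, of y] by simp
    qed
    show ?thesis
    proof (cases "s < int ?m \<or> s > int D - int ?m")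
      case in_range: False
      then have "int (nat \<bar>s - N\<bar>) \<le> N - int ?m" using D by auto
      from both[OF this] show ?thesis by (cases "s \<le> N") (auto simp: fun_eq_iff)
    qed (rule out)
  qed
qed

subsection \<open>All matrix units are reached\<close>

definition Limage :: "nat \<Rightarrow> lmat set" where
  "Limage D = {r. \<exists>A\<in>Ralg D. acts D A r}"

definition lunit :: "nat \<times> nat \<Rightarrow> nat \<Rightarrow> nat \<Rightarrow> lmat" where
  "lunit l j k = (\<lambda>l' j' k'. of_bool (l' = l \<and> j' = j \<and> k' = k))"

lemma Limage_lam: "ldiag D (lam D) \<in> Limage D"
  using acts_A2J Ralg.gen_J unfolding Limage_def by blast

lemma Limage_theta: "ldiag D (theta D) \<in> Limage D"
  using acts_A2star Ralg.gen_star unfolding Limage_def by blast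

lemma Limage_ltri: "ltri D \<in> Limage D"
  using acts_A2Jbar Ralg.gen_Jbar unfolding Limage_def by blast

lemma Limage_one: "ldiag D (\<lambda>l j. 1) \<in> Limage D"
  using acts_mid Ralg.unit unfolding Limage_def by blast

lemma Limage_add: "r \<in> Limage D \<Longrightarrow> s \<in> Limage D \<Longrightarrow> (\<lambda>l j k. r l j k + s l j k) \<in> Limage D"
  using acts_madd Ralg.add unfolding Limage_def by blast

lemma Limage_smult: "r \<in> Limage D \<Longrightarrow> (\<lambda>l j k. c * r l j k) \<in> Limage D"
  using acts_msmult Ralg.smult unfolding Limage_def by blast

lemma Limage_lmul: "r \<in> Limage D \<Longrightarrow> s \<in> Limage D \<Longrightarrow> lmul D r s \<in> Limage D"
  using acts_mmul Ralg.mult unfolding Limage_def by blast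

lemma Limage_diff:
  assumes "r \<in> Limage D" "s \<in> Limage D"
  shows "(\<lambda>l j k. r l j k - s l j k) \<in> Limage D"
  using Limage_add[OF assms(1) Limage_smult[OF assms(2), of "-1"]] by simp

lemma Limage_sum:
  assumes "finite I" "\<And>i. i \<in> I \<Longrightarrow> u i \<in> Limage D"
  shows "(\<lambda>l j k. \<Sum>i\<in>I. u i l j k) \<in> Limage D"
  using assms
proof (induction I rule: finite_induct)
  case empty
  then show ?case using Limage_smult[OF Limage_one, where c = 0] by simp
next
  case (insert i I)
  then show ?case using Limage_add[of "u i" D "\<lambda>l j k. \<Sum>i\<in>I. u i l j k"] by simp
qed

lemma lmul_ldiag_right:
  "lmul D r (ldiag D \<phi>) = (\<lambda>l j k. if in_block D l j k then r l j k * \<phi> l k else 0)"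
proof (intro ext)
  fix l j k
  have "(\<Sum>i<bsize D l. r l j i * ldiag D \<phi> l i k) = (\<Sum>i<bsize D l. if i = k then r l j k * \<phi> l k else 0)"
    if "in_block D l j k" using that by (intro sum.cong) (auto simp: ldiag_def in_block_def)
  then show "lmul D r (ldiag D \<phi>) l j k = (if in_block D l j k then r l j k * \<phi> l k else 0)"
    by (simp add: lmul_def in_block_def)
qed

lemma lmul_ldiag_left:
  "lmul D (ldiag D \<phi>) r = (\<lambda>l j k. if in_block D l j k then \<phi> l j * r l j k else 0)"
proof (intro ext)
  fix l j k
  have "(\<Sum>i<bsize D l. ldiag D \<phi> l j i * r l i k) = (\<Sum>i<bsize D l. if i = j then \<phi> l j * r l j k else 0)"
    if "in_block D l j k" using that by (intro sum.cong) (auto simp: ldiag_def in_block_def)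
  then show "lmul D (ldiag D \<phi>) r l j k = (if in_block D l j k then \<phi> l j * r l j k else 0)"
    by (simp add: lmul_def in_block_def)
qed

lemma lmul_lunit_left:
  assumes "k < bsize D l"
  shows "lmul D (lunit l i k) r = (\<lambda>l' j' k'. if in_block D l' j' k' \<and> l' = l \<and> j' = i then r l k k' else 0)"
proof (intro ext)
  fix l' j' k'
  have "(\<Sum>n<bsize D l'. lunit l i k l' j' n * r l' n k') =
      (\<Sum>n<bsize D l'. if n = k then (if l' = l \<and> j' = i then r l k k' else 0) else 0)"
    by (intro sum.cong) (auto simp: lunit_def)
  then show "lmul D (lunit l i k) r l' j' k' = (if in_block D l' j' k' \<and> l' = l \<and> j' = i then r l k k' else 0)"
    using assms by (auto simp: lmul_def)
qed

lemma lmul_lunit_right: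
  assumes "k < bsize D l"
  shows "lmul D r (lunit l k i) = (\<lambda>l' j' k'. if in_block D l' j' k' \<and> l' = l \<and> k' = i then r l j' k else 0)"
proof (intro ext)
  fix l' j' k'
  have "(\<Sum>n<bsize D l'. r l' j' n * lunit l k i l' n k') =
      (\<Sum>n<bsize D l'. if n = k then (if l' = l \<and> k' = i then r l j' k else 0) else 0)"
    by (intro sum.cong) (auto simp: lunit_def)
  then show "lmul D r (lunit l k i) l' j' k' = (if in_block D l' j' k' \<and> l' = l \<and> k' = i then r l j' k else 0)"
    using assms by (auto simp: lmul_def)
qed

lemma Limage_ldiag_mult:
  assumes "ldiag D \<phi> \<in> Limage D" "ldiag D \<psi> \<in> Limage D"
  shows "ldiag D (\<lambda>l j. \<phi> l j * \<psi> l j) \<in> Limage D"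
proof -
  have "lmul D (ldiag D \<phi>) (ldiag D \<psi>) = ldiag D (\<lambda>l j. \<phi> l j * \<psi> l j)"
    unfolding lmul_ldiag_left by (auto simp: ldiag_def fun_eq_iff)
  then show ?thesis using Limage_lmul[OF assms] by simp
qed

lemma Limage_ldiag_affine:
  assumes "ldiag D \<phi> \<in> Limage D"
  shows "ldiag D (\<lambda>l j. (\<phi> l j - w) / c) \<in> Limage D"
proof -
  have "ldiag D (\<lambda>l j. (\<phi> l j - w) / c) = (\<lambda>l j k. (1 / c) * (ldiag D \<phi> l j k - w * ldiag D (\<lambda>l j. 1) l j k))"
    by (auto simp: ldiag_def fun_eq_iff)
  then show ?thesis
    by (simp only: Limage_smult[OF Limage_diff[OF assms Limage_smult[OF Limage_one]]])
qed

text \<open>Lagrange interpolation: spectral idempotents are polynomials in the diagonal element.\<close>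

lemma Limage_level_set:
  assumes "ldiag D \<phi> \<in> Limage D"
  shows "ldiag D (\<lambda>l j. of_bool (\<phi> l j = c)) \<in> Limage D"
proof -
  define W where "W = (\<lambda>(l, j). \<phi> l j) ` (SIGMA l:Labels D. {..<bsize D l}) - {c}"
  have fin: "finite W" unfolding W_def by auto
  have "ldiag D (\<lambda>l j. \<Prod>w\<in>V. (\<phi> l j - w) / (c - w)) \<in> Limage D" if "finite V" for V
    using that
  proof (induction V rule: finite_induct)
    case empty
    then show ?case using Limage_one by simp
  next
    case (insert w V)
    then show ?case using Limage_ldiag_mult[OF Limage_ldiag_affine[OF assms] insert.IH, of w "c - w"] by simp
  qed
  then have "ldiag D (\<lambda>l j. \<Prod>w\<in>W. (\<phi> l j - w) / (c - w)) \<in> Limage D" using fin by blast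
  moreover have "ldiag D (\<lambda>l j. \<Prod>w\<in>W. (\<phi> l j - w) / (c - w)) = ldiag D (\<lambda>l j. of_bool (\<phi> l j = c))"
  proof -
    have "(\<Prod>w\<in>W. (\<phi> l j - w) / (c - w)) = of_bool (\<phi> l j = c)" if "in_block D l j j" for l j
    proof (cases "\<phi> l j = c")
      case True
      then show ?thesis by (auto simp: W_def intro!: prod.neutral)
    next
      case False
      then have "\<phi> l j \<in> W" using that by (force simp: W_def in_block_def)
      then show ?thesis using fin False by auto
    qed
    then show ?thesis by (auto simp: ldiag_def fun_eq_iff)
  qed
  ultimately show ?thesis by simp
qed

section \<open>Joint eigenvalues of the two diagonal generators\<close>

definition same_char :: "nat \<Rightarrow> nat \<times> nat \<Rightarrow> nat \<Rightarrow> nat \<times> nat \<Rightarrow> nat \<Rightarrow> bool" where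
  "same_char D l j l' j' \<longleftrightarrow> lam D l j = lam D l' j' \<and> theta D l j = theta D l' j'"

lemma Limage_idem: "ldiag D (\<lambda>l j. of_bool (same_char D l j l' j')) \<in> Limage D"
  using Limage_ldiag_mult[OF Limage_level_set[OF Limage_lam, where c = "lam D l' j'"]
      Limage_level_set[OF Limage_theta, where c = "theta D l' j'"]]
  by (simp add: same_char_def of_bool_conj)

text \<open>Equal \<open>theta\<close> gives equal |D - 2s|, hence equal s(D - s). Equal
  \<open>lam\<close> then gives (m - m')(D + 1 - m - m') = 0, whose second factor is positive
  because 2m and 2m' are at most D.\<close>

lemma same_charD:
  assumes "same_char D l j l' j'" "l \<in> Labels D" "l' \<in> Labels D"
  shows "fst l = fst l'"
    "\<bar>int D - 2 * (top_level D l - 2 * int j)\<bar> = \<bar>int D - 2 * (top_level D l' - 2 * int j')\<bar>"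
proof -
  define s s' where "s = top_level D l - 2 * int j" and "s' = top_level D l' - 2 * int j'"
  define m m' where "m = int (fst l)" and "m' = int (fst l')"
  have "(of_int ((int D - 2 * s)\<^sup>2 - int D) :: complex) = of_int ((int D - 2 * s')\<^sup>2 - int D)"
    using assms(1) unfolding same_char_def theta_def s_def[symmetric] s'_def[symmetric] by simp
  then have sq: "(int D - 2 * s)\<^sup>2 = (int D - 2 * s')\<^sup>2" unfolding of_int_eq_iff by simp
  then show "\<bar>int D - 2 * (top_level D l - 2 * int j)\<bar> = \<bar>int D - 2 * (top_level D l' - 2 * int j')\<bar>"
    unfolding s_def s'_def by (simp add: abs_eq_iff power2_eq_iff)
  have "s * (int D - s) - m * (int D + 1 - m) = s' * (int D - s') - m' * (int D + 1 - m')"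
    using assms(1) unfolding same_char_def lam_def s_def[symmetric] s'_def[symmetric] m_def m'_def of_int_eq_iff by simp
  moreover have "4 * (s * (int D - s)) = 4 * (s' * (int D - s'))"
    using sq by (simp add: power2_eq_square algebra_simps)
  ultimately have "(m - m') * (int D + 1 - m - m') = 0" by (simp add: algebra_simps)
  moreover have "2 * m \<le> int D" "2 * m' \<le> int D"
    using Labels_le[OF assms(2)] Labels_le[OF assms(3)] by (auto simp: m_def m'_def)
  ultimately show "fst l = fst l'" by (auto simp: m_def m'_def)
qed

text \<open>For even \<open>D\<close> the distance of the top level from the middle; index j lies at
  distance \<open>offset l + 2 * j\<close>.\<close>

definition offset :: "nat \<times> nat \<Rightarrow> nat" where
  "offset l = (if snd l = 0 then 0 else if snd l = 1 then 2 else 1)"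

text \<open>The weights D - 2s within a part are odd and congruent mod 4, so no two of them are
  negatives of each other.\<close>

lemma same_char_odd:
  assumes "same_char D l j l' j'" "l \<in> Labels D" "l' \<in> Labels D" "odd D"
  shows "l = l' \<and> j = j'"
proof -
  note * = same_charD[OF assms(1-3)]
  have l: "l = l'" using * assms by (auto simp: Labels_def prod_eq_iff)
  obtain q where q: "int D = 2 * q + 1" using assms(4) by (metis even_of_nat oddE)
  have "int D - 2 * (int D - int (fst l) - 1 - 2 * int j) = int D - 2 * (int D - int (fst l) - 1 - 2 * int j')
     \<or> int D - 2 * (int D - int (fst l) - 1 - 2 * int j) = - (int D - 2 * (int D - int (fst l) - 1 - 2 * int j'))"
    using *(2) assms(4) l by (simp add: top_level_def abs_eq_iff)
  then have "j = j'"
  proof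
    assume "int D - 2 * (int D - int (fst l) - 1 - 2 * int j) = - (int D - 2 * (int D - int (fst l) - 1 - 2 * int j'))"
    then show ?thesis unfolding q by presburger
  qed simp
  then show ?thesis using l by simp
qed

lemma same_char_even:
  assumes "same_char D l j l' j'" "l \<in> Labels D" "l' \<in> Labels D" "even D"
  shows "fst l = fst l' \<and> offset l + 2 * j = offset l' + 2 * j'"
proof -
  note * = same_charD[OF assms(1-3)]
  have h: "int D - 2 * (top_level D l - 2 * int j) = 2 * int (offset l + 2 * j)" for l j
    using assms(4) int_half[of D] by (auto simp: top_level_def offset_def)
  show ?thesis using * unfolding h by simp
qed

lemma same_char_same_label:
  "same_char D l j l j' \<Longrightarrow> l \<in> Labels D \<Longrightarrow> j = j'"
  using same_char_odd[of D l j l j'] same_char_even[of D l j l j'] by (cases "odd D") auto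

text \<open>Positivity is preserved by addition, so the \<open>bvec_turn\<close> correction in
  \<open>ltri\<close> cannot cancel the main coefficient.\<close>

lemma up_pos: "int m \<le> s \<Longrightarrow> 0 < Re (up m s)"
proof -
  assume "int m \<le> s"
  then have "0 < (s + 1 - int m) * (s + 2 - int m)" by simp
  then have "0 < real_of_int ((s + 1 - int m) * (s + 2 - int m))" by (simp only: of_int_0_less_iff)
  then show ?thesis unfolding up_def by simp
qed

lemma ltri_super:
  assumes "l \<in> Labels D" "Suc k < bsize D l"
  shows "ltri D l k (Suc k) \<noteq> 0"
proof -
  have "0 < Re (up (fst l) (top_level D l - 2 * int (Suc k)))"
    using assms(2) unfolding less_bsize_iff by (rule up_pos)
  then have "up (fst l) (top_level D l - 2 * int (Suc k)) \<noteq> 0" by force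
  then show ?thesis using assms by (simp add: ltri_def in_block_def)
qed

lemma ltri_sub:
  assumes "l \<in> Labels D" "Suc k < bsize D l"
  shows "ltri D l (Suc k) k \<noteq> 0"
proof -
  have "int (fst l) \<le> top_level D l" using assms(2) unfolding less_bsize_iff by simp
  then have "0 < Re (up (fst l) (top_level D l))" by (rule up_pos)
  moreover have "0 < Re (up (fst l) (int D - top_level D l + 2 * int k))"
    using top_level_le[OF assms(1)] by (intro up_pos) simp
  ultimately have "0 < Re (ltri D l (Suc k) k)"
    using assms by (cases "k = 0") (auto simp: ltri_def in_block_def bvec_turn_def)
  then show ?thesis by force
qed

lemma ltri_loop:
  assumes "l \<in> Labels D" "0 < bsize D l" "even D" "snd l = 2 \<or> snd l = 3"
  shows "ltri D l 0 0 \<noteq> 0"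
proof -
  have "int (fst l) \<le> top_level D l" using assms(2) unfolding less_bsize_iff by simp
  then have "0 < Re (up (fst l) (top_level D l))" by (rule up_pos)
  then have "up (fst l) (top_level D l) \<noteq> 0" by force
  then show ?thesis using assms by (auto simp: ltri_def in_block_def bvec_loop_def)
qed

text \<open>Multiplying a unit of row 0 or column 0 by the tridiagonal matrix reaches the
  neighbouring index with a nonzero entry. The idempotent of that index cuts off the rest, and
  products of a column unit with a row unit give all units.\<close>

lemma Limage_lunit_of_first:
  assumes l: "l \<in> Labels D" and first: "lunit l 0 0 \<in> Limage D" and j: "j < bsize D l" and k: "k < bsize D l"
  shows "lunit l j k \<in> Limage D"
proof -
  let ?e = "\<lambda>i. ldiag D (\<lambda>l' j'. of_bool (same_char D l' j' l i))"
  have sc: "same_char D l x l i \<longleftrightarrow> x = i" for x i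
    using same_char_same_label[OF _ l] by (auto simp: same_char_def)
  have row: "k < bsize D l \<Longrightarrow> lunit l 0 k \<in> Limage D" for k
  proof (induction k)
    case (Suc k)
    let ?t = "ltri D l k (Suc k)"
    have "lmul D (lmul D (lunit l 0 k) (ltri D)) (?e (Suc k)) = (\<lambda>l' j' k'. ?t * lunit l 0 (Suc k) l' j' k')"
      unfolding lmul_ldiag_right using Suc.prems l
      by (subst lmul_lunit_left)
         (auto simp: fun_eq_iff lunit_def in_block_def sc)
    then have "(\<lambda>l' j' k'. ?t * lunit l 0 (Suc k) l' j' k') \<in> Limage D"
      using Limage_lmul[OF Limage_lmul[OF Suc.IH Limage_ltri] Limage_idem] Suc.prems by (metis Suc_lessD)
    from Limage_smult[OF this, of "1 / ?t"] show ?case using ltri_super[OF l Suc.prems] by simp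
  qed (rule first)
  have col: "j < bsize D l \<Longrightarrow> lunit l j 0 \<in> Limage D" for j
  proof (induction j)
    case (Suc j)
    let ?t = "ltri D l (Suc j) j"
    have "lmul D (?e (Suc j)) (lmul D (ltri D) (lunit l j 0)) = (\<lambda>l' j' k'. ?t * lunit l (Suc j) 0 l' j' k')"
      unfolding lmul_ldiag_left using Suc.prems l
      by (subst lmul_lunit_right)
         (auto simp: fun_eq_iff lunit_def in_block_def sc)
    then have "(\<lambda>l' j' k'. ?t * lunit l (Suc j) 0 l' j' k') \<in> Limage D"
      using Limage_lmul[OF Limage_idem Limage_lmul[OF Limage_ltri Suc.IH]] Suc.prems by (metis Suc_lessD)
    from Limage_smult[OF this, of "1 / ?t"] show ?case using ltri_sub[OF l Suc.prems] by simp
  qed (rule first)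
  have "lmul D (lunit l j 0) (lunit l 0 k) = lunit l j k"
    using j k l by (subst lmul_lunit_left) (auto simp: fun_eq_iff lunit_def in_block_def)
  then show ?thesis using Limage_lmul[OF col[OF j] row[OF k]] by simp
qed

lemma same_char_even_iff:
  assumes "l \<in> Labels D" "l' \<in> Labels D" "even D"
  shows "same_char D l j l' j' \<longleftrightarrow> fst l = fst l' \<and> offset l + 2 * j = offset l' + 2 * j'"
proof
  assume r: "fst l = fst l' \<and> offset l + 2 * j = offset l' + 2 * j'"
  have "top_level D l - 2 * int j = int (D div 2) - int (offset l + 2 * j)" for l j
    using assms(3) by (auto simp: top_level_def offset_def)
  then have "top_level D l - 2 * int j = top_level D l' - 2 * int j'" using r by simp
  then show "same_char D l j l' j'" using r by (simp add: same_char_def lam_def theta_def)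
qed (use same_char_even assms in blast)

text \<open>For odd \<open>D\<close> the idempotent of the joint eigenvalue is already the unit. For
  even \<open>D\<close> this holds for label 0; label 1 shares its first eigenvalue with index 1 of
  label 0, whose unit is known and is subtracted; labels 2 and 3 share theirs and are told apart by
  the sign of the loop entry of \<open>ltri\<close>.\<close>

lemma Limage_lunit_first:
  assumes l: "l \<in> Labels D" and pos: "0 < bsize D l"
  shows "lunit l 0 0 \<in> Limage D"
proof (cases "odd D")
  case True
  have "ldiag D (\<lambda>l' j'. of_bool (same_char D l' j' l 0)) = lunit l 0 0"
    using same_char_odd[OF _ _ l True] l pos
    by (fastforce simp: fun_eq_iff ldiag_def lunit_def in_block_def same_char_def)
  then show ?thesis using Limage_idem[of D l 0] by simp
next
  case False
  then have ev: "even D" by simp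
  let ?m = "fst l"
  have m: "?m \<le> D div 2" using l False by (auto simp: Labels_def)
  have lab: "(?m, t) \<in> Labels D \<longleftrightarrow> t < 4" for t using m False by (auto simp: Labels_def)
  have off3: "t = 0 \<or> t = 1 \<or> t = 2 \<or> t = 3" if "(a, t) \<in> Labels D" for a t
    using that False by (auto simp: Labels_def)
  have first0: "lunit (?m, 0) 0 0 \<in> Limage D" if "0 < bsize D (?m, 0)"
  proof -
    have "ldiag D (\<lambda>l' j'. of_bool (same_char D l' j' (?m, 0) 0)) = lunit (?m, 0) 0 0"
    proof (intro ext)
      fix l' j' k'
      show "ldiag D (\<lambda>l' j'. of_bool (same_char D l' j' (?m, 0) 0)) l' j' k' = lunit (?m, 0) 0 0 l' j' k'"
        using same_char_even_iff[OF _ _ ev, of l' "(?m, 0)" j' 0] lab[of 0] that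
        by (cases l') (auto simp: ldiag_def lunit_def in_block_def offset_def split: if_splits)
    qed
    then show ?thesis using Limage_idem[of D "(?m, 0)" 0] by simp
  qed
  have "snd l < 4" using lab[of "snd l"] l by simp
  then consider "snd l = 0" | "snd l = 1" | "snd l = 2 \<or> snd l = 3" by linarith
  then show ?thesis
  proof cases
    case 1
    then show ?thesis using first0 pos by (metis prod.collapse)
  next
    case 2
    then have l1: "l = (?m, 1)" by (simp add: prod_eq_iff)
    \<comment> \<open>The top level of label 1 is the level of index 1 of label 0.\<close>
    have b: "1 < bsize D (?m, 0)" using pos ev unfolding less_bsize_iff
      by (subst (asm) l1) (auto simp: top_level_def)
    have u: "lunit (?m, 0) 1 1 \<in> Limage D"
      using Limage_lunit_of_first[OF _ first0 b b] lab[of 0] b by simp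
    have e: "ldiag D (\<lambda>l' j'. of_bool (same_char D l' j' (?m, 1) 0)) =
       (\<lambda>l' j' k'. lunit (?m, 1) 0 0 l' j' k' + lunit (?m, 0) 1 1 l' j' k')"
    proof (intro ext)
      fix l' j' k'
      show "ldiag D (\<lambda>l' j'. of_bool (same_char D l' j' (?m, 1) 0)) l' j' k' =
          lunit (?m, 1) 0 0 l' j' k' + lunit (?m, 0) 1 1 l' j' k'"
        using same_char_even_iff[OF _ _ ev, of l' "(?m, 1)" j' 0] lab[of 0] lab[of 1] b pos l1 off3
        by (cases l') (auto simp: ldiag_def lunit_def in_block_def offset_def split: if_splits)
    qed
    from Limage_diff[OF Limage_idem[of D "(?m, 1)" 0, unfolded e] u]
    show ?thesis by (subst l1) simp
  next
    case 3
    have l3: "l = (?m, 2) \<or> l = (?m, 3)" using 3 by (auto simp: prod_eq_iff)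
    have eq: "bsize D (?m, 2) = bsize D l" "bsize D (?m, 3) = bsize D l"
      using 3 by (auto simp: bsize_def top_level_def)
    let ?e = "ldiag D (\<lambda>l' j'. of_bool (same_char D l' j' (?m, 2) 0))"
    let ?t = "ltri D (?m, 2) 0 0"
    have e: "?e = (\<lambda>l' j' k'. lunit (?m, 2) 0 0 l' j' k' + lunit (?m, 3) 0 0 l' j' k')"
    proof (intro ext)
      fix l' j' k'
      show "?e l' j' k' = lunit (?m, 2) 0 0 l' j' k' + lunit (?m, 3) 0 0 l' j' k'"
      proof (cases "l' \<in> Labels D")
        case True
        obtain a b where l': "l' = (a, b)" by (cases l')
        have b: "b = 0 \<or> b = 1 \<or> b = 2 \<or> b = 3" using off3 True l' by blast
        have "offset (a, b) + 2 * j' = 1 \<longleftrightarrow> (b = 2 \<or> b = 3) \<and> j' = 0"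
        proof
          assume h: "offset (a, b) + 2 * j' = 1"
          then have "odd (offset (a, b))" by presburger
          then show "(b = 2 \<or> b = 3) \<and> j' = 0" using b h by (auto simp: offset_def split: if_splits)
        qed (auto simp: offset_def)
        then have "same_char D l' j' (?m, 2) 0 \<longleftrightarrow> a = ?m \<and> (b = 2 \<or> b = 3) \<and> j' = 0"
          using same_char_even_iff[OF True _ ev, of "(?m, 2)" j' 0] lab[of 2] l'
          by (simp add: offset_def)
        then show ?thesis using True pos eq l' by (auto simp: ldiag_def lunit_def in_block_def)
      next
        case False
        then show ?thesis using lab[of 2] lab[of 3] by (auto simp: ldiag_def lunit_def in_block_def)
      qed
    qed
    have eL: "?e \<in> Limage D" by (rule Limage_idem)
    have t3: "ltri D (?m, 3) 0 0 = - ?t"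
      using ev lab[of 2] lab[of 3] pos eq by (simp add: ltri_def in_block_def bvec_loop_def top_level_def)
    have t: "?t \<noteq> 0" using ltri_loop[of "(?m, 2)" D] lab[of 2] pos eq ev by simp
    \<comment> \<open>Compressing the tridiagonal matrix by the idempotent leaves only the two loop
      entries, which are opposite. This gives the difference of the two units, and the idempotent is
      their sum.\<close>
    have ete: "lmul D (lmul D ?e (ltri D)) ?e = (\<lambda>l' j' k'. ?t * (lunit (?m, 2) 0 0 l' j' k' - lunit (?m, 3) 0 0 l' j' k'))"
    proof (intro ext)
      fix l' j' k'
      have "lmul D (lmul D ?e (ltri D)) ?e l' j' k' = ?e l' j' j' * ltri D l' j' k' * ?e l' k' k'"
        unfolding lmul_ldiag_right lmul_ldiag_left
        by (auto simp: ldiag_def in_block_def ltri_def)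
      also have "\<dots> = ?t * (lunit (?m, 2) 0 0 l' j' k' - lunit (?m, 3) 0 0 l' j' k')"
        unfolding e using t3 by (auto simp: lunit_def)
      finally show "lmul D (lmul D ?e (ltri D)) ?e l' j' k' = \<dots>" .
    qed
    from Limage_smult[OF Limage_lmul[OF Limage_lmul[OF eL Limage_ltri] eL, unfolded ete], of "1 / ?t"]
    have d: "(\<lambda>l' j' k'. lunit (?m, 2) 0 0 l' j' k' - lunit (?m, 3) 0 0 l' j' k') \<in> Limage D" using t by simp
    have "lunit (?m, 2) 0 0 \<in> Limage D"
      using Limage_smult[OF Limage_add[OF eL[unfolded e] d], of "1/2"] by simp
    moreover have "lunit (?m, 3) 0 0 \<in> Limage D"
      using Limage_smult[OF Limage_diff[OF eL[unfolded e] d], of "1/2"] by simp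
    ultimately show ?thesis using l3 by metis
  qed
qed

lemma Limage_eq: "Limage D = {r. \<forall>l j k. \<not> in_block D l j k \<longrightarrow> r l j k = 0}"
proof (intro equalityI subsetI)
  fix r :: lmat assume "r \<in> Limage D"
  then show "r \<in> {r. \<forall>l j k. \<not> in_block D l j k \<longrightarrow> r l j k = 0}"
    by (auto simp: Limage_def acts_def)
next
  fix r :: lmat assume r: "r \<in> {r. \<forall>l j k. \<not> in_block D l j k \<longrightarrow> r l j k = 0}"
  let ?I = "SIGMA l:Labels D. {..<bsize D l} \<times> {..<bsize D l}"
  have fin: "finite ?I" by auto
  let ?u = "\<lambda>(l, j, k) l' j' k'. r l j k * lunit l j k l' j' k'"
  have "(\<lambda>l' j' k'. \<Sum>p\<in>?I. ?u p l' j' k') \<in> Limage D"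
  proof (rule Limage_sum[OF fin])
    fix p assume "p \<in> ?I"
    then obtain l j k where p: "p = (l, j, k)" "l \<in> Labels D" "j < bsize D l" "k < bsize D l" by auto
    then have "lunit l j k \<in> Limage D"
      using Limage_lunit_of_first[OF p(2) Limage_lunit_first[OF p(2)] p(3,4)] by simp
    then show "?u p \<in> Limage D" using Limage_smult p(1) by auto
  qed
  moreover have "(\<lambda>l' j' k'. \<Sum>p\<in>?I. ?u p l' j' k') = r"
  proof (intro ext)
    fix l' j' k'
    have "(\<Sum>p\<in>?I. ?u p l' j' k') = (\<Sum>p\<in>?I. if p = (l', j', k') then r l' j' k' else 0)"
      by (intro sum.cong) (auto simp: lunit_def)
    also have "\<dots> = r l' j' k'"
    proof (cases "in_block D l' j' k'")
      case True
      then show ?thesis using fin by (simp add: in_block_def)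
    next
      case False
      then have "r l' j' k' = 0" using r by blast
      then show ?thesis by simp
    qed
    finally show "(\<Sum>p\<in>?I. ?u p l' j' k') = r l' j' k'" .
  qed
  ultimately show "r \<in> Limage D" by simp
qed

section \<open>The isomorphism with the block algebra\<close>

definition repr :: "nat \<Rightarrow> cmat \<Rightarrow> lmat" where
  "repr D A = (THE r. acts D A r)"

lemma repr_eq: "acts D A r \<Longrightarrow> repr D A = r"
  unfolding repr_def using acts_unique by blast

lemma acts_repr: "A \<in> Ralg D \<Longrightarrow> acts D A (repr D A)"
  using acts_exists repr_eq by metis

lemma repr_inj:
  assumes "A \<in> Ralg D" "B \<in> Ralg D" "repr D A = repr D B"
  shows "A = B"
proof -
  let ?C = "madd A (msmult (-1) B)"
  have "?C \<in> Ralg D" using assms by (intro Ralg.intros)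
  moreover have "acts D ?C (\<lambda>l j k. 0)"
    using acts_madd[OF acts_repr[OF assms(1)] acts_msmult[OF acts_repr[OF assms(2)], of "-1"]] assms(3) by simp
  ultimately have "?C = (\<lambda>y x. 0)" by (rule acts_zero_imp_zero)
  then show ?thesis by (auto simp: madd_def msmult_def fun_eq_iff)
qed

text \<open>Any enumeration of the nonempty labels works; its order becomes the order of the
  blocks.\<close>

lemma R_iso_Blocks_labels:
  assumes dist: "distinct ls" and set_ls: "set ls = {l \<in> Labels D. 0 < bsize D l}"
  shows "R_iso_Blocks D (map (bsize D) ls)"
proof -
  let ?ns = "map (bsize D) ls"
  define f where "f A = (\<lambda>i j k. if i < length ls then repr D A (ls ! i) j k else 0)" for A
  have lab: "ls ! i \<in> Labels D" if "i < length ls" for i using that set_ls nth_mem by blast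
  have inb: "in_block D (ls ! i) j k \<longleftrightarrow> j < bsize D (ls ! i) \<and> k < bsize D (ls ! i)" if "i < length ls" for i j k
    using lab[OF that] by (simp add: in_block_def)
  have idx: "\<exists>i<length ls. ls ! i = l" if "in_block D l j k" for l j k
  proof -
    have "l \<in> set ls" using that set_ls by (auto simp: in_block_def)
    then show ?thesis by (simp add: in_set_conv_nth)
  qed
  have "inj_on f (Ralg D)"
  proof (rule inj_onI)
    fix A B assume AB: "A \<in> Ralg D" "B \<in> Ralg D" "f A = f B"
    have "repr D A l j k = repr D B l j k" for l j k
    proof (cases "in_block D l j k")
      case True
      then obtain i where "i < length ls" "ls ! i = l" using idx by blast
      then show ?thesis using fun_cong[OF fun_cong[OF fun_cong[OF AB(3), of i], of j], of k] by (simp add: f_def)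
    next
      case False
      then show ?thesis using acts_support acts_repr AB by metis
    qed
    then show "A = B" using repr_inj AB by (simp add: fun_eq_iff)
  qed
  moreover have "f ` Ralg D = BlockAlg ?ns"
  proof (intro equalityI subsetI)
    fix N assume "N \<in> f ` Ralg D"
    then obtain A where A: "A \<in> Ralg D" "N = f A" by blast
    show "N \<in> BlockAlg ?ns"
      unfolding BlockAlg_def A(2)
      using acts_support[OF acts_repr[OF A(1)]] by (auto simp: f_def inb)
  next
    fix N assume N: "N \<in> BlockAlg ?ns"
    \<comment> \<open>The position of a label in the list, used to read a block matrix as a family
      indexed by labels.\<close>
    define pos where "pos l = (THE i. i < length ls \<and> ls ! i = l)" for l
    have pos: "pos (ls ! i) = i" if "i < length ls" for i
      unfolding pos_def using that dist by (auto simp: nth_eq_iff_index_eq)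
    define r where "r = (\<lambda>l j k. if in_block D l j k then N (pos l) j k else 0)"
    have "r \<in> Limage D" unfolding Limage_eq r_def by auto
    then obtain A where A: "A \<in> Ralg D" "acts D A r" unfolding Limage_def by blast
    have "f A = N"
    proof (intro ext)
      fix i j k
      have "N i j k = 0" if "\<not> (i < length ls \<and> j < bsize D (ls ! i) \<and> k < bsize D (ls ! i))"
        using N that by (cases "i < length ls") (auto simp: BlockAlg_def)
      then show "f A i j k = N i j k"
        using repr_eq[OF A(2)] by (auto simp: f_def r_def inb pos)
    qed
    then show "N \<in> f ` Ralg D" using A(1) by blast
  qed
  ultimately have "bij_betw f (Ralg D) (BlockAlg ?ns)" by (simp add: bij_betw_def)
  moreover have "f (madd A B) = badd (f A) (f B)" if "A \<in> Ralg D" "B \<in> Ralg D" for A B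
    unfolding f_def repr_eq[OF acts_madd[OF that[THEN acts_repr]]] by (auto simp: badd_def fun_eq_iff)
  moreover have "f (msmult c A) = bsmult c (f A)" if "A \<in> Ralg D" for A c
    unfolding f_def repr_eq[OF acts_msmult[OF acts_repr[OF that]]] by (auto simp: bsmult_def fun_eq_iff)
  moreover have "f (mmul D A B) = bmul ?ns (f A) (f B)" if "A \<in> Ralg D" "B \<in> Ralg D" for A B
    unfolding f_def repr_eq[OF acts_mmul[OF that(1) that[THEN acts_repr]]]
    by (auto simp: bmul_def lmul_def inb fun_eq_iff)
  moreover have "f (mid D) = bone ?ns"
    unfolding f_def repr_eq[OF acts_mid] by (auto simp: bone_def ldiag_def inb fun_eq_iff)
  ultimately show ?thesis unfolding R_iso_Blocks_def by blast
qed

subsection \<open>Block sizes\<close>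

text \<open>Lifts an equality of multisets of sizes to an enumeration of the labels whose sizes
  appear in exactly the prescribed order.\<close>

lemma image_mset_eq_mset:
  assumes "image_mset f M = mset ys"
  obtains xs where "mset xs = M" "map f xs = ys"
proof -
  have "\<exists>xs. mset xs = M \<and> map f xs = ys" using assms
  proof (induction ys arbitrary: M)
    case (Cons y ys)
    then have "image_mset f M = add_mset y (mset ys)" by simp
    then obtain M1 x where M: "M = add_mset x M1" "f x = y" "image_mset f M1 = mset ys"
      by (metis msed_map_invR)
    from Cons.IH[OF M(3)] obtain xs where "mset xs = M1" "map f xs = ys" by blast
    then show ?case using M by (intro exI[of _ "x # xs"]) simp
  qed simp
  then show ?thesis using that by blast
qed

lemma image_mset_mset_set_sum:
  "finite S \<Longrightarrow> image_mset f (mset_set S) = (\<Sum>x\<in>S. {#f x#})"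
  by (induction S rule: finite_induct) auto

definition pos_part :: "nat \<Rightarrow> nat multiset" where
  "pos_part x = (if 0 < x then {#x#} else {#})"

lemma bsize_odd: "bsize (2 * q + 1) (m, 0) = q + 1 - m"
  unfolding bsize_def top_level_def by (simp; linarith)

lemma bsize_even:
  assumes "m \<le> N"
  shows "bsize (2 * N) (m, 0) = (N - m) div 2 + 1" "bsize (2 * N) (m, 1) = (N - m) div 2"
    "bsize (2 * N) (m, 2) = (N - m + 1) div 2" "bsize (2 * N) (m, 3) = (N - m + 1) div 2"
proof -
  obtain x where N: "N = m + x" using assms le_Suc_ex by blast
  show "bsize (2 * N) (m, 0) = (N - m) div 2 + 1" "bsize (2 * N) (m, 1) = (N - m) div 2"
    "bsize (2 * N) (m, 2) = (N - m + 1) div 2" "bsize (2 * N) (m, 3) = (N - m + 1) div 2"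
    unfolding bsize_def top_level_def N by (simp_all; linarith)+
qed

text \<open>The nonzero sizes of the four parts with x = D/2 - m.\<close>

definition quad_sizes :: "nat \<Rightarrow> nat multiset" where
  "quad_sizes x = pos_part (x div 2 + 1) + pos_part (x div 2) + pos_part ((x + 1) div 2) + pos_part ((x + 1) div 2)"

lemma mset_eight_blocks_Suc: "mset (eight_blocks (Suc q)) = mset (eight_blocks q) + replicate_mset 8 (Suc q)"
  by (simp add: eight_blocks_def)

text \<open>A size k >= 1 occurs 1, 3, 3 and 1 times at x = 2k - 2, 2k - 1, 2k and 2k + 1, hence
  eight times in a complete range. Cutting the range off leaves the multiplicities 4, or 7 and 1,
  for the largest sizes.\<close>

lemma sum_quad_sizes:
  "(\<Sum>x\<le>2 * q + 1. quad_sizes x) = replicate_mset 4 (q + 1) + mset (eight_blocks q)"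
  "(\<Sum>x\<le>2 * q + 2. quad_sizes x) = {#q + 2#} + replicate_mset 7 (q + 1) + mset (eight_blocks q)"
proof -
  have step: "(\<Sum>x\<le>2 * q + 2. quad_sizes x) = {#q + 2#} + replicate_mset 7 (q + 1) + mset (eight_blocks q)"
    if "(\<Sum>x\<le>2 * q + 1. quad_sizes x) = replicate_mset 4 (q + 1) + mset (eight_blocks q)" for q
  proof -
    have "(\<Sum>x\<le>2 * q + 2. quad_sizes x) = (\<Sum>x\<le>2 * q + 1. quad_sizes x) + quad_sizes (2 * q + 2)" by simp
    also have "quad_sizes (2 * q + 2) = {#q + 2#} + replicate_mset 3 (q + 1)"
      by (simp add: quad_sizes_def pos_part_def numeral_3_eq_3)
    finally show ?thesis unfolding that by (simp add: eval_nat_numeral)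
  qed
  show 1: "(\<Sum>x\<le>2 * q + 1. quad_sizes x) = replicate_mset 4 (q + 1) + mset (eight_blocks q)"
  proof (induction q)
    case 0
    show ?case by (simp add: quad_sizes_def pos_part_def eight_blocks_def eval_nat_numeral)
  next
    case (Suc q)
    have "(\<Sum>x\<le>2 * Suc q + 1. quad_sizes x) = (\<Sum>x\<le>2 * q + 2. quad_sizes x) + quad_sizes (2 * q + 3)"
      by (simp add: eval_nat_numeral)
    also have "quad_sizes (2 * q + 3) = {#q + 1#} + replicate_mset 3 (q + 2)"
      by (simp add: quad_sizes_def pos_part_def numeral_3_eq_3)
    finally show ?case unfolding step[OF Suc.IH] mset_eight_blocks_Suc by (simp add: eval_nat_numeral)
  qed
  show "(\<Sum>x\<le>2 * q + 2. quad_sizes x) = {#q + 2#} + replicate_mset 7 (q + 1) + mset (eight_blocks q)"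
    by (rule step[OF 1])
qed

lemma mset_block_sizes:
  assumes "2 \<le> D"
  shows "image_mset (bsize D) (mset_set {l \<in> Labels D. 0 < bsize D l}) = mset (block_sizes D)"
proof -
  have "image_mset (bsize D) (mset_set {l \<in> Labels D. 0 < bsize D l}) =
      (\<Sum>l\<in>{l \<in> Labels D. 0 < bsize D l}. {#bsize D l#})"
    by (simp add: image_mset_mset_set_sum)
  also have "\<dots> = (\<Sum>l\<in>Labels D. pos_part (bsize D l))"
    unfolding pos_part_def by (rule sum.inter_filter) simp
  finally have eq: "image_mset (bsize D) (mset_set {l \<in> Labels D. 0 < bsize D l}) = \<dots>" .
  show ?thesis
  proof (cases "odd D")
    case True
    then obtain q where q: "D = 2 * q + 1" by (rule oddE)
    have "(\<Sum>l\<in>Labels D. pos_part (bsize D l)) = (\<Sum>m\<le>q. pos_part (bsize D (m, 0)))"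
      using True by (intro sum.reindex_bij_witness[of _ "\<lambda>m. (m, 0)" fst]) (auto simp: Labels_def q)
    also have "\<dots> = (\<Sum>m\<le>q. {#q + 1 - m#})"
      unfolding q bsize_odd by (intro sum.cong) (auto simp: pos_part_def)
    also have "\<dots> = (\<Sum>k\<in>{1..<q + 2}. {#k#})"
      by (rule sum.reindex_bij_witness[of _ "\<lambda>k. q + 1 - k" "\<lambda>m. q + 1 - m"]) auto
    also have "\<dots> = mset (block_sizes D)"
      using image_mset_mset_set_sum[of "{1..<q + 2}" "\<lambda>k. k"]
      by (simp add: block_sizes_def q del: upt_Suc)
    finally show ?thesis using eq by simp
  next
    case False
    then obtain N where N: "D = 2 * N" by auto
    have t4: "{..<4::nat} = {0, 1, 2, 3}" by auto
    have "(\<Sum>l\<in>Labels D. pos_part (bsize D l)) = (\<Sum>m\<le>N. \<Sum>t<4. pos_part (bsize D (m, t)))"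
      unfolding Labels_def N by (simp add: sum.cartesian_product)
    also have "\<dots> = (\<Sum>m\<le>N. quad_sizes (N - m))"
      unfolding N t4 by (intro sum.cong refl) (simp add: bsize_even[simplified] quad_sizes_def add_ac)
    also have "\<dots> = (\<Sum>x\<le>N. quad_sizes x)"
      by (rule sum.reindex_bij_witness[of _ "\<lambda>k. N - k" "\<lambda>m. N - m"]) auto
    also have "\<dots> = mset (block_sizes D)"
    proof (cases "odd N")
      case True
      then obtain q where q: "N = 2 * q + 1" by (rule oddE)
      have "D mod 4 = 2" "(D + 2) div 4 = q + 1" "(D - 2) div 4 = q" using N q by presburger+
      then show ?thesis using False sum_quad_sizes(1)[of q] by (simp add: q block_sizes_def)
    next
      case even: False
      then obtain q' where q': "N = 2 * q'" by auto
      then obtain q where q: "N = 2 * q + 2" using assms N by (cases q') auto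
      have "D mod 4 = 0" "D div 4 = q + 1" using N q by presburger+
      then show ?thesis using False sum_quad_sizes(2)[of q] by (simp add: q block_sizes_def)
    qed
    finally show ?thesis using eq by simp
  qed
qed

lemma R_iso_block_sizes:
  assumes "2 \<le> D"
  shows "R_iso_Blocks D (block_sizes D)"
proof -
  let ?S = "{l \<in> Labels D. 0 < bsize D l}"
  have fin: "finite ?S" by simp
  obtain ls where ls: "mset ls = mset_set ?S" "map (bsize D) ls = block_sizes D"
    using image_mset_eq_mset[OF mset_block_sizes[OF assms]] .
  have set_ls: "set ls = ?S" using arg_cong[OF ls(1), of set_mset] fin by simp
  have "card (set ls) = length ls"
    using arg_cong[OF ls(1), of size] set_ls by simp
  then have "distinct ls" by (rule card_distinct)
  from R_iso_Blocks_labels[OF this set_ls] show ?thesis unfolding ls(2) .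
qed

subsection \<open>Dimension\<close>

lemma vector_space_msmult: "vector_space msmult"
  by unfold_locales (auto simp: msmult_def fun_eq_iff algebra_simps)

text \<open>The preimages of the matrix units under the isomorphism form a basis.\<close>

lemma dim_Ralg:
  assumes "R_iso_Blocks D ns"
  shows "vector_space.dim msmult (Ralg D) = sum_list (map (\<lambda>n. n\<^sup>2) ns)"
proof -
  interpret V: vector_space msmult by (rule vector_space_msmult)
  obtain f where bij: "bij_betw f (Ralg D) (BlockAlg ns)"
    and f_add: "\<And>A B. A \<in> Ralg D \<Longrightarrow> B \<in> Ralg D \<Longrightarrow> f (madd A B) = badd (f A) (f B)"
    and f_smult: "\<And>A c. A \<in> Ralg D \<Longrightarrow> f (msmult c A) = bsmult c (f A)"
    using assms unfolding R_iso_Blocks_def by blast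
  define I where "I = (SIGMA i:{..<length ns}. {..<ns ! i} \<times> {..<ns ! i})"
  have finI: "finite I" by (simp add: I_def)
  define E :: "nat \<times> nat \<times> nat \<Rightarrow> bmat" where
    "E p = (\<lambda>i j k. of_bool (p = (i, j, k)))" for p
  have E: "E p \<in> BlockAlg ns" if "p \<in> I" for p using that by (auto simp: E_def I_def BlockAlg_def)
  define e where "e p = inv_into (Ralg D) f (E p)" for p
  have e: "e p \<in> Ralg D" "f (e p) = E p" if "p \<in> I" for p
    using bij_betw_inv_into_right[OF bij E[OF that]] bij_betwE[OF bij_betw_inv_into[OF bij]] E[OF that]
    unfolding e_def by auto
  have zero: "(0 :: cmat) = msmult 0 (mid D)" by (simp add: msmult_def fun_eq_iff)
  have f0: "0 \<in> Ralg D" "f 0 = (\<lambda>i j k. 0)"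
    unfolding zero f_smult[OF Ralg.unit] by (intro Ralg.intros) (simp add: bsmult_def)
  have madd: "madd A B = A + B" for A B by (simp add: madd_def fun_eq_iff)
  \<comment> \<open>Linearity of \<open>f\<close> is known only on \<open>Ralg D\<close>, so
    membership of the partial sums is proved along with their images.\<close>
  have f_sum: "(\<Sum>p\<in>J. msmult (c p) (e p)) \<in> Ralg D \<and>
      f (\<Sum>p\<in>J. msmult (c p) (e p)) = (\<lambda>i j k. \<Sum>p\<in>J. c p * E p i j k)" if "J \<subseteq> I" for J c
    using finite_subset[OF that finI] that
  proof (induction J rule: finite_induct)
    case empty
    show ?case using f0 by (simp only: sum.empty simp_thms)
  next
    case (insert p J)
    let ?s = "\<Sum>p\<in>J. msmult (c p) (e p)"
    have pI: "p \<in> I" using insert.prems by simp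
    have p: "msmult (c p) (e p) \<in> Ralg D" by (rule Ralg.smult[OF e(1)[OF pI]])
    have s: "?s \<in> Ralg D" "f ?s = (\<lambda>i j k. \<Sum>p\<in>J. c p * E p i j k)" using insert by auto
    have "(\<Sum>p\<in>insert p J. msmult (c p) (e p)) = madd (msmult (c p) (e p)) ?s"
      using insert by (simp add: madd)
    then show ?case
      using Ralg.add[OF p s(1)] f_add[OF p s(1)] f_smult[OF e(1)[OF pI]] e(2)[OF pI] insert.hyps s(2)
      by (simp add: badd_def bsmult_def)
  qed
  have f_sumI: "f (\<Sum>p\<in>I. msmult (c p) (e p)) i j k = (if (i, j, k) \<in> I then c (i, j, k) else 0)" for c i j k
  proof -
    have "f (\<Sum>p\<in>I. msmult (c p) (e p)) i j k = (\<Sum>p\<in>I. if p = (i, j, k) then c (i, j, k) else 0)"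
      using f_sum[of I c] by (auto simp: E_def intro!: sum.cong)
    then show ?thesis using finI by simp
  qed
  have inj_e: "inj_on e I"
  proof (rule inj_onI)
    fix p q assume "p \<in> I" "q \<in> I" "e p = e q"
    then have "E p = E q" using e by metis
    moreover obtain i j k where p: "p = (i, j, k)" by (cases p)
    ultimately have "E q i j k = E (i, j, k) i j k" by simp
    then show "p = q" unfolding E_def p by (simp split: if_splits)
  qed
  have "V.dim (Ralg D) = card (e ` I)"
  proof (rule V.dim_unique)
    show "e ` I \<subseteq> Ralg D" using e by auto
    show "Ralg D \<subseteq> V.span (e ` I)"
    proof
      fix A assume A: "A \<in> Ralg D"
      let ?s = "\<Sum>p\<in>I. msmult (case p of (i, j, k) \<Rightarrow> f A i j k) (e p)"
      have "f A \<in> BlockAlg ns" using A bij by (auto simp: bij_betw_def)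
      then have "f A = f ?s" unfolding fun_eq_iff f_sumI by (auto simp: BlockAlg_def I_def)
      moreover have "?s \<in> Ralg D" using f_sum[of I] by blast
      ultimately have "A = ?s" by (intro inj_onD[OF bij_betw_imp_inj_on[OF bij]] A)
      also have "?s \<in> V.span (e ` I)"
        by (intro V.span_sum V.span_scale V.span_base) auto
      finally show "A \<in> V.span (e ` I)" .
    qed
    show "V.independent (e ` I)"
    proof (rule V.independent_if_scalars_zero)
      show "finite (e ` I)" using finI by simp
      fix c x assume s: "(\<Sum>x\<in>e ` I. msmult (c x) x) = 0" and "x \<in> e ` I"
      then obtain p where p: "p \<in> I" "x = e p" by blast
      have "(\<Sum>p\<in>I. msmult (c (e p)) (e p)) = 0" using s inj_e by (simp add: sum.reindex)
      then have z: "f (\<Sum>p\<in>I. msmult (c (e p)) (e p)) = (\<lambda>i j k. 0)" using f0 by simp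
      obtain i j k where ijk: "p = (i, j, k)" by (cases p)
      show "c x = 0" using f_sumI[of "\<lambda>p. c (e p)" i j k] p unfolding z ijk by simp
    qed
  qed simp
  also have "\<dots> = card I" by (rule card_image[OF inj_e])
  also have "\<dots> = (\<Sum>i<length ns. (ns ! i)\<^sup>2)"
    by (simp add: I_def power2_eq_square)
  also have "\<dots> = sum_list (map (\<lambda>n. n\<^sup>2) ns)"
    by (simp add: sum_list_sum_nth atLeast0LessThan)
  finally show ?thesis .
qed

lemma choose_3: "6 * ((n + 2) choose 3) = (n + 2) * (n + 1) * n"
proof (induction n)
  case (Suc n)
  have "2 * ((n + 2) choose 2) = (n + 2) * (n + 1)" by (simp add: choose_two)
  moreover have "(Suc n + 2) choose 3 = ((n + 2) choose 2) + ((n + 2) choose 3)"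
    by (simp add: numeral_3_eq_3 numeral_2_eq_2)
  ultimately show ?case using Suc by (simp add: algebra_simps)
qed simp

lemma sum_squares_upt: "6 * sum_list (map (\<lambda>n. n\<^sup>2) [1..<q + 1]) = q * (q + 1) * (2 * q + 1)"
  by (induction q) (auto simp: algebra_simps power2_eq_square)

lemma sum_squares_eight_blocks:
  "sum_list (map (\<lambda>n. n\<^sup>2) (eight_blocks q)) = 8 * sum_list (map (\<lambda>n. n\<^sup>2) [1..<q + 1])"
  by (induction q) (auto simp: eight_blocks_def sum_list_replicate)

lemma sum_squares_block_sizes:
  assumes "2 \<le> D"
  shows "sum_list (map (\<lambda>n. n\<^sup>2) (block_sizes D)) =
    ((D div 2 + 3) choose 3) + (((D + 1) div 2 + 1) choose 3)" (is "?L = ?R")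
proof -
  consider q where "D = 2 * q + 1" | q where "D = 4 * q + 2" | q where "D = 4 * q + 4"
  proof -
    have "(\<exists>q. D = 2 * q + 1) \<or> (\<exists>q. D = 4 * q + 2) \<or> (\<exists>q. D = 4 * q + 4)" using assms by presburger
    then show ?thesis using that by blast
  qed
  \<comment> \<open>Clearing the denominator 6 turns the binomials and sums of squares into
    polynomial identities over the naturals.\<close>
  then have "6 * ?L = 6 * ?R"
  proof cases
    case 1
    have L: "?L = sum_list (map (\<lambda>n. n\<^sup>2) [1..<(q + 1) + 1])"
      by (simp add: block_sizes_def 1 del: upt_Suc)
    have R: "D div 2 + 3 = (q + 1) + 2" "(D + 1) div 2 + 1 = q + 2" using 1 by auto
    show ?thesis unfolding L R distrib_left[of 6] sum_squares_upt choose_3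
      by (simp add: algebra_simps)
  next
    case 2
    have "D mod 4 = 2" "(D + 2) div 4 = q + 1" "(D - 2) div 4 = q" "even D" using 2 by presburger+
    then have L: "6 * ?L = 24 * (q + 1)\<^sup>2 + 8 * (6 * sum_list (map (\<lambda>n. n\<^sup>2) [1..<q + 1]))"
      by (simp add: block_sizes_def sum_squares_eight_blocks sum_list_replicate del: upt_Suc)
    have R: "D div 2 + 3 = (2 * q + 2) + 2" "(D + 1) div 2 + 1 = 2 * q + 2" using 2 by auto
    show ?thesis unfolding L R distrib_left[of 6] sum_squares_upt choose_3
      by (simp add: algebra_simps power2_eq_square)
  next
    case 3
    have "D mod 4 = 0" "D div 4 = q + 1" "even D" using 3 by presburger+
    then have L: "6 * ?L = 6 * (q + 2)\<^sup>2 + 42 * (q + 1)\<^sup>2 + 8 * (6 * sum_list (map (\<lambda>n. n\<^sup>2) [1..<q + 1]))"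
      by (simp add: block_sizes_def sum_squares_eight_blocks sum_list_replicate del: upt_Suc)
    have R: "D div 2 + 3 = (2 * q + 3) + 2" "(D + 1) div 2 + 1 = (2 * q + 1) + 2" using 3 by auto
    show ?thesis unfolding L R distrib_left[of 6] sum_squares_upt choose_3
      by (simp add: algebra_simps power2_eq_square)
  qed
  then show ?thesis by simp
qed

theorem theorem9p4:
  fixes D :: nat
  assumes "D \<ge> 2"
  shows "R_iso_Blocks D (block_sizes D) \<and>
         vector_space.dim msmult (Ralg D)
           = ((D div 2 + 3) choose 3) + (((D + 1) div 2 + 1) choose 3)"
  using R_iso_block_sizes[OF assms] dim_Ralg sum_squares_block_sizes[OF assms] by simp

end
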